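(* Let $\sigma=\begin{pmatrix}0&1&0\\0&0&1\\1&0&0\end{pmatrix}$ and $\tau=\begin{pmatrix}-1&1&0\\ i&i&0\\0&0&1-i\end{pmatrix}$, viewed in $PGU_3(\mathbb{Z}[1/2])$. Then the group $\Lambda_2=\langle\sigma,\tau\rangle$ acts simply-transitively on the edges of the $3$-regular Bruhat–Tits tree of $PGU_3(\mathbb{Q}_2)$, and $\Lambda_2=\langle\sigma,\tau\mid\sigma^3,\tau^3\rangle\cong\mathbb{Z}/3\mathbb{Z}*\mathbb{Z}/3\mathbb{Z}$.
   Context: For a commutative ring $R$, $PGU_3(R)=\{g\in GL_3(R[\sqrt{-1}]) : gg^*=\lambda I,\ \lambda\in R^\times\}/R[\sqrt{-1}]^\times$, $g^*$ the conjugate transpose. The Bruhat–Tits building of $PGU_3(\mathbb{Q}_2)$ is a $3$-regular tree. *)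

theory Defs
  imports "HOL-Analysis.Analysis"
begin

section \<open>Rings: Z[1/2], Z[i], Z[1/2][i] inside the complex numbers\<close>

definition dyadic :: "real set" where
  "dyadic = {of_int a / 2 ^ k | a k. True}"

definition unitZh :: "real \<Rightarrow> bool" where
  "unitZh l \<longleftrightarrow> l \<in> dyadic \<and> l \<noteq> 0 \<and> inverse l \<in> dyadic"

definition Gint :: "complex set" where
  "Gint = {Complex (of_int a) (of_int b) | a b. True}"

definition Dg :: "complex set" where
  "Dg = {z. Re z \<in> dyadic \<and> Im z \<in> dyadic}"

definition unitDg :: "complex \<Rightarrow> bool" where
  "unitDg u \<longleftrightarrow> u \<in> Dg \<and> u \<noteq> 0 \<and> inverse u \<in> Dg"

section \<open>GU_3(Z[1/2]) and PGU_3(Z[1/2])\<close>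

type_synonym cmat = "complex^3^3"
type_synonym cvec = "complex^3"

definition mstar :: "cmat \<Rightarrow> cmat" where
  "mstar g = (\<chi> i j. cnj (g $ j $ i))"

definition GU3 :: "cmat set" where
  "GU3 = {g. (\<forall>i j. g $ i $ j \<in> Dg) \<and>
              (\<exists>l. unitZh l \<and> g ** mstar g = mat (complex_of_real l))}"

text \<open>Equality in PGU_3: equality up to a unit scalar of Z[1/2][i].\<close>
definition pgu_eq :: "cmat \<Rightarrow> cmat \<Rightarrow> bool" where
  "pgu_eq g h \<longleftrightarrow> (\<exists>u. unitDg u \<and> h = mat u ** g)"

definition pgu_trivial :: "cmat \<Rightarrow> bool" where
  "pgu_trivial g \<longleftrightarrow> (\<exists>u. unitDg u \<and> g = mat u)"

section \<open>The Bruhat--Tits tree via lattices\<close>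

definition Ovec :: "cvec set" where
  "Ovec = {x. \<forall>i. x $ i \<in> Gint}"

definition scaleset :: "complex \<Rightarrow> cvec set \<Rightarrow> cvec set" where
  "scaleset c L = (\<lambda>x. c *s x) ` L"

text \<open>Z[i]-lattices in Z[1/2][i]^3 of full rank (these correspond bijectively to
  Z_2[i]-lattices in Q_2(i)^3).\<close>
definition is_lattice :: "cvec set \<Rightarrow> bool" where
  "is_lattice L \<longleftrightarrow> 0 \<in> L \<and> (\<forall>x\<in>L. \<forall>y\<in>L. x + y \<in> L) \<and>
     (\<forall>a\<in>Gint. \<forall>x\<in>L. a *s x \<in> L) \<and>
     (\<exists>n::nat. scaleset (2 ^ n) Ovec \<subseteq> L \<and> L \<subseteq> scaleset (1 / 2 ^ n) Ovec)"

definition hform :: "cvec \<Rightarrow> cvec \<Rightarrow> complex" where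
  "hform x y = (\<Sum>i\<in>UNIV. x $ i * cnj (y $ i))"

definition dual :: "cvec set \<Rightarrow> cvec set" where
  "dual L = {y. \<forall>x\<in>L. hform x y \<in> Gint}"

definition unif :: complex where
  "unif = 1 - \<i>"

text \<open>Edges (= chambers) of the Bruhat--Tits tree of PGU_3(Q_2): pairs (L0, M) with
  L0 self-dual and M/(pi L0) an isotropic line in L0/(pi L0); equivalently the
  duality-stable chambers {L0, M, pi M^#} of the building of GL_3(Q_2(i)).\<close>
definition BT_edges :: "(cvec set \<times> cvec set) set" where
  "BT_edges = {(L0, M). is_lattice L0 \<and> is_lattice M \<and> dual L0 = L0 \<and> M \<subseteq> L0 \<and>
      scaleset unif L0 \<subset> M \<and> M \<subset> scaleset unif (dual M)}"

text \<open>Action of g in GU_3 (with g g^* = l I) on lattices: L \<mapsto> c g L, where c is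
  a scalar of Z[1/2][i] with |c|^2 l = 1 (unique up to a power of i), so that
  self-dual lattices go to self-dual lattices.\<close>
definition gscale :: "cmat \<Rightarrow> complex" where
  "gscale g = (SOME c. c \<in> Dg \<and>
      (\<exists>l. g ** mstar g = mat (complex_of_real l) \<and> (cmod c)\<^sup>2 * l = 1))"

definition act_lat :: "cmat \<Rightarrow> cvec set \<Rightarrow> cvec set" where
  "act_lat g L = (\<lambda>x. gscale g *s (g *v x)) ` L"

definition act_edge :: "cmat \<Rightarrow> cvec set \<times> cvec set \<Rightarrow> cvec set \<times> cvec set" where
  "act_edge g e = (act_lat g (fst e), act_lat g (snd e))"

section \<open>The elements sigma3, tau3 and the group Lambda_2\<close>

definition sigma3 :: cmat where
  "sigma3 = vector [vector [0, 1, 0], vector [0, 0, 1], vector [1, 0, 0]]"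

definition tau3 :: cmat where
  "tau3 = vector [vector [-1, 1, 0], vector [\<i>, \<i>, 0], vector [0, 0, 1 - \<i>]]"

text \<open>Preimage of Lambda_2 = <sigma3, tau3> in GL_3: products of sigma3, tau3 and their
  inverses, times unit scalars.\<close>
definition Lam2 :: "cmat set" where
  "Lam2 = {mat u ** foldr (**) ws (mat 1) | u ws. unitDg u \<and>
             set ws \<subseteq> {sigma3, tau3, matrix_inv sigma3, matrix_inv tau3}}"

fun mpow :: "cmat \<Rightarrow> nat \<Rightarrow> cmat" where
  "mpow g 0 = mat 1"
| "mpow g (Suc n) = g ** mpow g n"

text \<open>Words in normal form for Z/3 * Z/3: letters (True,k) = sigma3^k, (False,k) = tau3^k,
  k \<in> {1,2}, consecutive letters from different factors.\<close>
definition alt_word :: "(bool \<times> nat) list \<Rightarrow> bool" where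
  "alt_word w \<longleftrightarrow> (\<forall>l\<in>set w. snd l \<in> {1, 2}) \<and>
     (\<forall>i. Suc i < length w \<longrightarrow> fst (w ! i) \<noteq> fst (w ! Suc i))"

fun word_mat :: "(bool \<times> nat) list \<Rightarrow> cmat" where
  "word_mat [] = mat 1"
| "word_mat ((b, k) # w) = mpow (if b then sigma3 else tau3) k ** word_mat w"

end

theory Submission
  imports Defs
begin

text \<open>Write \<open>\<tau> = unif \<cdot> \<tau>'\<close> with \<open>unif = 1 - i\<close>. Both \<open>\<sigma>\<close> and \<open>\<tau>'\<close> are unitary of order 3, so up to
  scalars \<open>\<Lambda>\<^sub>2\<close> is the group \<open>Lambda_u\<close> they generate, acting on \<open>Z[i]\<close>-lattices through
  unitary matrices. Reduction modulo \<open>unif\<close> turns the hermitian form into the form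
  \<open>x\<^sub>1y\<^sub>1 + x\<^sub>2y\<^sub>2 + x\<^sub>3y\<^sub>3\<close> on \<open>F\<^sub>2\<^sup>3\<close>, whose three isotropic lines \<open>(1,1,0), (1,0,1), (0,1,1)\<close> are the
  edges at the standard vertex \<open>Ovec\<close>; \<open>\<sigma>\<close> permutes them cyclically.

  Transitivity: if \<open>unif\<^sup>n\<^sup>+\<^sup>1 L\<close> but not \<open>unif\<^sup>n L\<close> is integral for a self-dual \<open>L\<close>, then the
  reduction of \<open>unif\<^sup>n\<^sup>+\<^sup>1 L\<close> is an isotropic line, which \<open>\<sigma>\<^sup>a\<close> moves to \<open>(1,1,0)\<close>, and then \<open>\<tau>'\<close> or
  \<open>\<tau>'\<^sup>2\<close> makes \<open>unif\<^sup>n L\<close> integral. By induction every vertex, and then every edge, is in the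
  orbit of the standard one.

  Freeness and the presentation follow from a ping-pong argument on vectors \<open>unif\<^sup>-\<^sup>k y\<close> with
  \<open>y\<close> integral: \<open>\<sigma>\<^sup>\<plusminus>\<^sup>1\<close> maps those with \<open>y \<equiv> (1,1,0)\<close> to those with \<open>y \<equiv> (1,0,1)\<close> or \<open>(0,1,1)\<close>, and
  \<open>\<tau>'\<^sup>\<plusminus>\<^sup>1\<close> maps the latter to the former with \<open>k\<close> raised by one. Hence an alternating word
  containing \<open>\<tau>'\<close> does not fix \<open>Ovec\<close>, the stabiliser of the standard edge is trivial, and
  no nonempty alternating word is a scalar.\<close>

section \<open>Gaussian integers and reduction modulo the uniformizer\<close>

definition gauss :: "int \<Rightarrow> int \<Rightarrow> complex" where
  "gauss a b = Complex (of_int a) (of_int b)"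

lemma Gint_iff_gauss: "z \<in> Gint \<longleftrightarrow> (\<exists>a b. z = gauss a b)"
  by (auto simp: Gint_def gauss_def)

lemma gauss_in_Gint [simp]: "gauss a b \<in> Gint"
  by (auto simp: Gint_iff_gauss)

lemma GintE:
  assumes "z \<in> Gint"
  obtains a b where "z = gauss a b"
  using assms by (auto simp: Gint_iff_gauss)

lemma gauss_arith:
  "gauss a b + gauss c d = gauss (a + c) (b + d)"
  "gauss a b - gauss c d = gauss (a - c) (b - d)"
  "- gauss a b = gauss (- a) (- b)"
  "gauss a b * gauss c d = gauss (a * c - b * d) (a * d + b * c)"
  "cnj (gauss a b) = gauss a (- b)"
  by (simp_all add: gauss_def complex_eq_iff)

lemma gauss_eq_iff: "gauss a b = gauss c d \<longleftrightarrow> a = c \<and> b = d"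
  by (simp add: gauss_def complex_eq_iff)

lemma gauss_consts: "0 = gauss 0 0" "1 = gauss 1 0" "\<i> = gauss 0 1" "2 = gauss 2 0"
  "unif = gauss 1 (- 1)"
  by (simp_all add: gauss_def unif_def complex_eq_iff)

lemma Gint_closed [simp]:
  "a \<in> Gint \<Longrightarrow> b \<in> Gint \<Longrightarrow> a + b \<in> Gint"
  "a \<in> Gint \<Longrightarrow> b \<in> Gint \<Longrightarrow> a - b \<in> Gint"
  "a \<in> Gint \<Longrightarrow> b \<in> Gint \<Longrightarrow> a * b \<in> Gint"
  "a \<in> Gint \<Longrightarrow> - a \<in> Gint"
  "a \<in> Gint \<Longrightarrow> cnj a \<in> Gint"
  by (auto simp: gauss_arith elim!: GintE)

lemma Gint_consts [simp]: "0 \<in> Gint" "1 \<in> Gint" "\<i> \<in> Gint" "2 \<in> Gint" "unif \<in> Gint"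
  by (simp_all only: gauss_consts gauss_in_Gint)

lemma Gint_power [simp]: "a \<in> Gint \<Longrightarrow> a ^ n \<in> Gint"
  by (induct n) auto

text \<open>\<open>red_pi z\<close> is the residue of \<open>z\<close> in \<open>Z[i]/(unif) = F\<^sub>2\<close>, encoded as a boolean.\<close>

definition red_pi :: "complex \<Rightarrow> bool" where
  "red_pi z \<longleftrightarrow> (\<exists>a b. z = gauss a b \<and> odd (a + b))"

lemma red_pi_gauss [simp]: "red_pi (gauss a b) \<longleftrightarrow> odd (a + b)"
  by (auto simp: red_pi_def gauss_eq_iff)

lemma red_pi_arith:
  assumes "a \<in> Gint" "b \<in> Gint"
  shows "red_pi (a + b) \<longleftrightarrow> red_pi a \<noteq> red_pi b"
    and "red_pi (a - b) \<longleftrightarrow> red_pi a \<noteq> red_pi b"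
    and "red_pi (a * b) \<longleftrightarrow> red_pi a \<and> red_pi b"
  using assms by (auto simp: gauss_arith elim!: GintE)

lemma red_pi_uminus_cnj:
  assumes "a \<in> Gint"
  shows "red_pi (- a) \<longleftrightarrow> red_pi a" and "red_pi (cnj a) \<longleftrightarrow> red_pi a"
  using assms by (auto simp: gauss_arith elim!: GintE)

lemma red_pi_consts [simp]: "\<not> red_pi 0" "red_pi 1" "red_pi \<i>" "\<not> red_pi 2" "\<not> red_pi unif"
  by (simp_all only: gauss_consts red_pi_gauss) simp_all

lemma not_red_pi_iff_dvd:
  assumes "a \<in> Gint"
  shows "\<not> red_pi a \<longleftrightarrow> (\<exists>w\<in>Gint. a = unif * w)"
proof
  assume "\<not> red_pi a"
  moreover obtain x y where a: "a = gauss x y" using assms by (rule GintE)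
  ultimately have "even (x + y)" by simp
  then obtain m where m: "x + y = 2 * m" by (rule evenE)
  have "a = unif * gauss (x - m) m"
    using m by (simp add: a gauss_consts(5) gauss_arith gauss_eq_iff)
  then show "\<exists>w\<in>Gint. a = unif * w" by auto
next
  assume "\<exists>w\<in>Gint. a = unif * w"
  then show "\<not> red_pi a" by (auto simp: red_pi_arith)
qed

definition two_dvd :: "complex \<Rightarrow> bool" where
  "two_dvd z \<longleftrightarrow> (\<exists>w\<in>Gint. z = 2 * w)"

lemma two_dvd_gauss: "two_dvd (gauss a b) \<longleftrightarrow> even a \<and> even b"
proof
  assume "two_dvd (gauss a b)"
  then obtain c d where "gauss a b = 2 * gauss c d" by (auto simp: two_dvd_def Gint_iff_gauss)
  then show "even a \<and> even b" by (simp add: gauss_consts(4) gauss_arith gauss_eq_iff)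
next
  assume "even a \<and> even b"
  then obtain c d where "a = 2 * c" "b = 2 * d" by (metis evenE)
  then have "gauss a b = 2 * gauss c d" by (simp add: gauss_consts(4) gauss_arith)
  then show "two_dvd (gauss a b)" by (auto simp: two_dvd_def)
qed

lemma two_dvd_imp_not_red_pi: "two_dvd z \<Longrightarrow> \<not> red_pi z"
  by (auto simp: two_dvd_def red_pi_arith)

lemma two_dvd_add: "two_dvd a \<Longrightarrow> two_dvd b \<Longrightarrow> two_dvd (a + b)"
  by (auto simp: two_dvd_def) (metis Gint_closed(1) distrib_left)

section \<open>Dyadic numbers and the units of \<open>Z[1/2][i]\<close>\<close>

lemma dyadic_iff: "x \<in> dyadic \<longleftrightarrow> (\<exists>a k. x = of_int a / 2 ^ k)"
  by (auto simp: dyadic_def)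

lemma dyadic_of_int [simp]: "of_int a \<in> dyadic"
  unfolding dyadic_iff by (rule exI[of _ a], rule exI[of _ 0]) simp

lemma dyadic_consts [simp]: "0 \<in> dyadic" "1 \<in> dyadic" "2 \<in> dyadic" "1 / 2 \<in> dyadic"
proof -
  have "(1::real) / 2 = of_int 1 / 2 ^ 1" by simp
  then show "1 / 2 \<in> dyadic" unfolding dyadic_iff by blast
qed (use dyadic_of_int[of 0] dyadic_of_int[of 1] dyadic_of_int[of 2] in simp_all)

lemma dyadic_common_denominator:
  assumes "x \<in> dyadic" "y \<in> dyadic"
  obtains a b k where "x = of_int a / 2 ^ k" "y = of_int b / 2 ^ k"
proof -
  obtain a k b l where x: "x = of_int a / 2 ^ k" and y: "y = of_int b / 2 ^ l"
    using assms by (auto simp: dyadic_iff)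
  have "x = of_int (a * 2 ^ l) / 2 ^ (k + l)" "y = of_int (b * 2 ^ k) / 2 ^ (k + l)"
    by (simp_all add: x y power_add)
  then show ?thesis using that by blast
qed

lemma dyadic_closed [simp]:
  "x \<in> dyadic \<Longrightarrow> y \<in> dyadic \<Longrightarrow> x + y \<in> dyadic"
  "x \<in> dyadic \<Longrightarrow> y \<in> dyadic \<Longrightarrow> x * y \<in> dyadic"
  "x \<in> dyadic \<Longrightarrow> - x \<in> dyadic"
proof -
  assume "x \<in> dyadic" "y \<in> dyadic"
  then obtain a b k where "x = of_int a / 2 ^ k" "y = of_int b / 2 ^ k"
    by (rule dyadic_common_denominator)
  then have "x + y = of_int (a + b) / 2 ^ k" "x * y = of_int (a * b) / 2 ^ (k + k)"
    by (simp_all add: add_divide_distrib power_add)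
  then show "x + y \<in> dyadic" "x * y \<in> dyadic" unfolding dyadic_iff by blast+
next
  assume "x \<in> dyadic"
  then obtain a k where "x = of_int a / 2 ^ k" by (auto simp: dyadic_iff)
  then have "- x = of_int (- a) / 2 ^ k" by simp
  then show "- x \<in> dyadic" unfolding dyadic_iff by blast
qed

lemma Dg_closed [simp]:
  "a \<in> Dg \<Longrightarrow> b \<in> Dg \<Longrightarrow> a + b \<in> Dg"
  "a \<in> Dg \<Longrightarrow> b \<in> Dg \<Longrightarrow> a * b \<in> Dg"
  "a \<in> Dg \<Longrightarrow> - a \<in> Dg"
  "a \<in> Dg \<Longrightarrow> cnj a \<in> Dg"
proof -
  assume "a \<in> Dg" "b \<in> Dg"
  then have "Re a * Re b + - (Im a * Im b) \<in> dyadic" "Re a * Im b + Im a * Re b \<in> dyadic"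
    unfolding Dg_def by (simp_all only: mem_Collect_eq dyadic_closed)
  then show "a * b \<in> Dg" unfolding Dg_def by simp
qed (simp_all add: Dg_def)

lemma Gint_subset_Dg: "a \<in> Gint \<Longrightarrow> a \<in> Dg"
  by (auto simp: Dg_def gauss_def elim!: GintE)

lemma even_square_mod_4: "(A::int)\<^sup>2 mod 4 = (if even A then 0 else 1)"
proof (cases "even A")
  case True
  then obtain p where "A = 2 * p" by (metis evenE)
  then show ?thesis using True by (simp add: power2_eq_square)
next
  case False
  then obtain p where "A = 2 * p + 1" by (metis oddE)
  then have "A\<^sup>2 = 4 * (p * p + p) + 1" by (simp add: power2_eq_square algebra_simps)
  then show ?thesis using False by presburger
qed

lemma sum_squares_eq_4_pow_dvd:
  "(A::int)\<^sup>2 + B\<^sup>2 = 4 ^ m \<Longrightarrow> 2 ^ m dvd A \<and> 2 ^ m dvd B"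
proof (induct m arbitrary: A B)
  case (Suc m)
  then have "(A\<^sup>2 mod 4 + B\<^sup>2 mod 4) mod 4 = 0" by (metis mod_add_eq mod_mult_self1_is_0 power_Suc)
  then have "even A \<and> even B" unfolding even_square_mod_4 by (auto split: if_splits)
  then obtain A' B' where AB: "A = 2 * A'" "B = 2 * B'" by (metis evenE)
  then have "A'\<^sup>2 + B'\<^sup>2 = 4 ^ m" using Suc.prems by (simp add: power2_eq_square)
  then show ?case using Suc.hyps AB by auto
qed simp

lemma Dg_norm_1_imp_Gint:
  assumes "z \<in> Dg" "cmod z = 1"
  shows "z \<in> Gint"
proof -
  obtain a b k where re: "Re z = of_int a / 2 ^ k" and im: "Im z = of_int b / 2 ^ k"
    using assms(1) unfolding Dg_def by (auto elim: dyadic_common_denominator)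
  have "(Re z)\<^sup>2 + (Im z)\<^sup>2 = 1" using assms(2) by (simp add: cmod_def)
  then have "(of_int a :: real)\<^sup>2 + (of_int b)\<^sup>2 = ((2::real) ^ k)\<^sup>2"
    using re im by (simp add: field_simps)
  also have "((2::real) ^ k)\<^sup>2 = of_int (4 ^ k)"
    by (simp add: power_mult[symmetric] mult.commute[of k 2] power_mult)
  finally have "a\<^sup>2 + b\<^sup>2 = 4 ^ k" by (simp only: of_int_eq_iff flip: of_int_power of_int_add)
  then have "2 ^ k dvd a" "2 ^ k dvd b" by (simp_all add: sum_squares_eq_4_pow_dvd)
  then obtain a' b' where "a = 2 ^ k * a'" "b = 2 ^ k * b'" by (elim dvdE)
  then have "z = gauss a' b'" using re im by (simp add: gauss_def complex_eq_iff)
  then show ?thesis by simp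
qed

lemma unitDg_mult: "unitDg a \<Longrightarrow> unitDg b \<Longrightarrow> unitDg (a * b)"
  by (auto simp: unitDg_def)

lemma unitDg_inverse: "unitDg a \<Longrightarrow> unitDg (inverse a)"
  by (auto simp: unitDg_def)

lemma unitDg_1: "unitDg 1"
  by (simp add: unitDg_def Gint_subset_Dg)

lemma unitDg_power: "unitDg a \<Longrightarrow> unitDg (a ^ n)"
  by (induct n) (simp_all add: unitDg_1 unitDg_mult)

lemma unif_nonzero [simp]: "unif \<noteq> 0"
  by (simp add: unif_def complex_eq_iff)

lemma unif_mult_cnj: "unif * cnj unif = 2"
  by (simp add: unif_def complex_eq_iff)

lemma inverse_unif: "inverse unif = (1 + \<i>) / 2"
  by (simp add: unif_def complex_eq_iff inverse_complex.code)

lemma unitDg_unif: "unitDg unif"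
  by (simp add: unitDg_def inverse_unif Gint_subset_Dg) (simp add: Dg_def unif_def)

lemma unitZh_1_2: "unitZh 1" "unitZh 2"
  by (simp_all add: unitZh_def)

section \<open>Unitary \<open>3 \<times> 3\<close> matrices\<close>

lemma mat_eq3: "(A::'a^3^3) = B \<longleftrightarrow>
    A$1$1 = B$1$1 \<and> A$1$2 = B$1$2 \<and> A$1$3 = B$1$3 \<and>
    A$2$1 = B$2$1 \<and> A$2$2 = B$2$2 \<and> A$2$3 = B$2$3 \<and>
    A$3$1 = B$3$1 \<and> A$3$2 = B$3$2 \<and> A$3$3 = B$3$3"
  by (auto simp: vec_eq_iff forall_3)

lemma vec_eq3: "(x::'a^3) = y \<longleftrightarrow> x$1 = y$1 \<and> x$2 = y$2 \<and> x$3 = y$3"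
  by (auto simp: vec_eq_iff forall_3)

lemma matrix_mult_nth3: "((A::'a::semiring_1^3^3) ** B)$i$j = A$i$1*B$1$j + A$i$2*B$2$j + A$i$3*B$3$j"
  by (simp add: matrix_matrix_mult_def sum_3)

lemma matrix_vector_mult_nth3: "((A::'a::semiring_1^3^3) *v x)$i = A$i$1*x$1 + A$i$2*x$2 + A$i$3*x$3"
  by (simp add: matrix_vector_mult_def sum_3)

lemma mat_nth: "(mat c :: 'a::zero^'n^'n) $ i $ j = (if i = j then c else 0)"
  by (simp add: mat_def)

lemma mstar_nth: "mstar A $ i $ j = cnj (A $ j $ i)"
  by (simp add: mstar_def)

lemma hform3: "hform x y = x$1 * cnj (y$1) + x$2 * cnj (y$2) + x$3 * cnj (y$3)"
  by (simp add: hform_def sum_3)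

lemmas matrix_simps3 = mat_eq3 matrix_mult_nth3 mat_nth mstar_nth

lemma mat_matrix_mult: "(mat a :: 'a::semiring_1^'n^'n) ** B = (\<chi> i j. a * B$i$j)"
  unfolding matrix_matrix_mult_def mat_def
  by (auto simp: vec_eq_iff if_distrib if_distribR sum.delta'[OF finite] cong: if_cong)

lemma mat_mult_mat: "(mat a :: 'a::semiring_1^'n^'n) ** mat b = mat (a * b)"
  unfolding mat_matrix_mult by (simp add: mat_def vec_eq_iff)

lemma mat_matrix_mult_comm: "(mat a :: cmat) ** (B :: cmat) = B ** mat a"
  by (simp add: mat_eq3 matrix_mult_nth3 mat_nth mult.commute)

lemma mat_matrix_vector_mult: "(mat a :: 'a::semiring_1^'n^'n) *v x = a *s x"
  unfolding matrix_vector_mult_def mat_def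
  by (auto simp: vec_eq_iff if_distrib if_distribR sum.delta'[OF finite] cong: if_cong)

lemma mat_eq_mat_iff: "(mat a :: 'a::zero^'n^'n) = mat b \<longleftrightarrow> a = b"
  by (metis mat_nth)

lemma matrix_mult_mat_left_commute: "(A::cmat) ** (mat c ** B) = mat c ** (A ** B)"
  by (simp only: matrix_mul_assoc mat_matrix_mult_comm)

lemma mstar_mult: "mstar (A ** B) = mstar B ** mstar A"
  by (simp add: mstar_def matrix_matrix_mult_def vec_eq_iff mult.commute)

lemma mstar_mat: "mstar (mat c) = mat (cnj c)"
  by (simp add: mstar_def mat_def vec_eq_iff)

lemma mstar_mstar [simp]: "mstar (mstar A) = A"
  by (simp add: mstar_def vec_eq_iff)

lemma hform_adjoint: "hform (A *v x) y = hform x (mstar A *v y)"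
  by (simp add: hform3 matrix_vector_mult_nth3 mstar_nth algebra_simps)

lemma hform_scale: "hform (c *s x) (d *s y) = c * cnj d * hform x y"
  by (simp add: hform3 algebra_simps)

definition unitary :: "cmat \<Rightarrow> bool" where
  "unitary U \<longleftrightarrow> U ** mstar U = mat 1 \<and> mstar U ** U = mat 1"

lemma unitary_1: "unitary (mat 1)"
  by (simp add: unitary_def mstar_mat)

lemma unitary_mult:
  assumes "unitary U" "unitary V"
  shows "unitary (U ** V)"
proof -
  have "U ** V ** (mstar V ** mstar U) = U ** (V ** mstar V) ** mstar U"
    "mstar V ** mstar U ** (U ** V) = mstar V ** (mstar U ** U) ** V"
    by (simp_all add: matrix_mul_assoc)
  then show ?thesis using assms by (simp add: unitary_def mstar_mult)
qed

lemma unitary_mstar: "unitary U \<Longrightarrow> unitary (mstar U)"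
  by (simp add: unitary_def)

lemma hform_unitary: "unitary U \<Longrightarrow> hform (U *v x) (U *v y) = hform x y"
  by (simp add: unitary_def hform_adjoint matrix_vector_mul_assoc)

lemma unitary_left_inverse:
  assumes "unitary U" "V ** U = mat 1"
  shows "V = mstar U"
proof -
  have "V = V ** (U ** mstar U)" using assms(1) by (simp add: unitary_def)
  also have "\<dots> = mstar U" by (simp add: matrix_mul_assoc assms(2))
  finally show ?thesis .
qed

lemma unitary_image_iff: "unitary U \<Longrightarrow> y \<in> (*v) U ` A \<longleftrightarrow> mstar U *v y \<in> A"
proof
  assume "unitary U" "y \<in> (*v) U ` A"
  then show "mstar U *v y \<in> A" by (auto simp: matrix_vector_mul_assoc unitary_def)
next
  assume "unitary U" "mstar U *v y \<in> A"
  moreover have "y = U *v (mstar U *v y)"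
    using \<open>unitary U\<close> by (simp add: matrix_vector_mul_assoc unitary_def)
  ultimately show "y \<in> (*v) U ` A" by blast
qed

lemma image_matrix_mult: "(*v) A ` ((*v) B ` L) = (*v) (A ** B) ` (L :: cvec set)"
  by (simp add: image_image matrix_vector_mul_assoc)

lemma unitary_image_cancel: "unitary U \<Longrightarrow> (*v) (mstar U) ` ((*v) U ` L) = L"
  by (simp add: image_matrix_mult unitary_def)

lemma matrix_inv_eq: "(A::cmat) ** B = mat 1 \<Longrightarrow> B ** A = mat 1 \<Longrightarrow> matrix_inv A = B"
proof -
  assume ab: "A ** B = mat 1" and ba: "B ** A = mat 1"
  have inv: "A ** matrix_inv A = mat 1 \<and> matrix_inv A ** A = mat 1"
    unfolding matrix_inv_def by (rule someI[of _ B]) (use ab ba in simp)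
  then have "matrix_inv A = matrix_inv A ** (A ** B)" using ab by simp
  also have "\<dots> = B" using inv by (simp add: matrix_mul_assoc)
  finally show ?thesis .
qed

lemma mpow_2: "mpow g 2 = g ** g"
  by (simp add: numeral_2_eq_2)

lemma mpow_3: "mpow g 3 = g ** g ** g"
  by (simp add: numeral_3_eq_3 matrix_mul_assoc)

lemma mpow_add: "mpow g (a + b) = mpow g a ** mpow g b"
  by (induct a) (simp_all add: matrix_mul_assoc)

lemma mpow_mod_order: "mpow g n = mat 1 \<Longrightarrow> mpow g k = mpow g (k mod n)"
proof -
  assume g: "mpow g n = mat 1"
  have "mpow g (n * q) = mat 1" for q by (induct q) (simp_all add: mpow_add g)
  then have "mpow g (n * (k div n)) ** mpow g (k mod n) = mpow g (k mod n)" by simp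
  then show ?thesis by (simp only: mpow_add[symmetric] mult_div_mod_eq)
qed

lemma unitary_mpow: "unitary g \<Longrightarrow> unitary (mpow g k)"
  by (induct k) (simp_all add: unitary_1 unitary_mult)

section \<open>The generators\<close>

definition tau_u :: cmat where
  "tau_u = mat (inverse unif) ** tau3"

lemma tau_u_explicit: "tau_u =
    vector [vector [- (1 + \<i>) / 2, (1 + \<i>) / 2, 0], vector [(\<i> - 1) / 2, (\<i> - 1) / 2, 0],
            vector [0, 0, 1]]"
  unfolding tau_u_def inverse_unif
  by (simp add: tau3_def matrix_simps3 field_simps complex_eq_iff)

lemma tau3_eq: "tau3 = mat unif ** tau_u"
proof -
  have "unif * inverse unif = 1" by (simp add: unif_def complex_eq_iff)
  then show ?thesis by (simp add: tau_u_def matrix_mul_assoc mat_mult_mat)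
qed

lemma sigma3_cube: "mpow sigma3 3 = mat 1"
  by (simp add: mpow_3 sigma3_def matrix_simps3)

lemma tau_u_cube: "mpow tau_u 3 = mat 1"
  by (simp add: mpow_3 tau_u_explicit matrix_simps3 field_simps complex_eq_iff)

lemma unitary_sigma3: "unitary sigma3"
  by (simp add: unitary_def sigma3_def matrix_simps3)

lemma unitary_tau_u: "unitary tau_u"
  by (simp add: unitary_def tau_u_explicit matrix_simps3 field_simps complex_eq_iff)

lemma sigma3_mult_vec:
  "sigma3 *v x = vector [x$2, x$3, x$1]"
  "(sigma3 ** sigma3) *v x = vector [x$3, x$1, x$2]"
  by (simp_all add: vec_eq3 matrix_vector_mult_nth3 matrix_mult_nth3 sigma3_def)

lemma tau_u_mult_vec:
  "tau_u *v y = inverse unif *s vector [y$2 - y$1, \<i> * (y$1 + y$2), unif * y$3]"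
  "(tau_u ** tau_u) *v y = inverse unif *s vector [\<i> * y$1 - y$2, - \<i> * y$1 - y$2, unif * y$3]"
  unfolding inverse_unif
  by (simp_all add: vec_eq3 matrix_vector_mult_nth3 matrix_mult_nth3 tau_u_explicit
      unif_def field_simps complex_eq_iff)

lemma matrix_inv_sigma3: "matrix_inv sigma3 = sigma3 ** sigma3"
  using sigma3_cube by (intro matrix_inv_eq) (simp_all add: mpow_3 matrix_mul_assoc)

lemma matrix_inv_tau3: "matrix_inv tau3 = mat (inverse unif) ** (tau_u ** tau_u)"
  unfolding inverse_unif
  by (rule matrix_inv_eq)
    (simp_all add: tau3_def tau_u_explicit matrix_simps3 field_simps complex_eq_iff)

section \<open>Words in the unitary generators\<close>

definition gen :: "bool \<Rightarrow> cmat" where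
  "gen b = (if b then sigma3 else tau_u)"

lemma gen_cube: "mpow (gen b) 3 = mat 1"
  by (simp add: gen_def sigma3_cube tau_u_cube)

lemma unitary_gen: "unitary (gen b)"
  by (simp add: gen_def unitary_sigma3 unitary_tau_u)

fun uword :: "(bool \<times> nat) list \<Rightarrow> cmat" where
  "uword [] = mat 1"
| "uword ((b, k) # w) = mpow (gen b) k ** uword w"

lemma uword_append: "uword (v @ w) = uword v ** uword w"
  by (induct v rule: uword.induct) (simp_all add: matrix_mul_assoc)

lemma unitary_uword: "unitary (uword w)"
  by (induct w rule: uword.induct) (simp_all add: unitary_1 unitary_mult unitary_mpow unitary_gen)

definition tau_degree :: "(bool \<times> nat) list \<Rightarrow> nat" where
  "tau_degree w = sum_list (map (\<lambda>(b, k). if b then 0 else k) w)"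

lemma mat_mult_collect_mat: "mat a ** ((B :: cmat) ** (mat c ** D)) = mat (a * c) ** (B ** (D :: cmat))"
proof -
  have "B ** (mat c ** D) = mat c ** (B ** D)" by (rule matrix_mult_mat_left_commute)
  then show ?thesis by (simp add: matrix_mul_assoc mat_mult_mat)
qed

lemma mpow_tau3: "mpow tau3 k = mat (unif ^ k) ** mpow tau_u k"
  by (induct k) (simp_all add: tau3_eq mat_mult_collect_mat flip: matrix_mul_assoc)

lemma word_mat_eq_uword: "word_mat w = mat (unif ^ tau_degree w) ** uword w"
proof (induct w rule: uword.induct)
  case (2 b k w)
  show ?case
  proof (cases b)
    case True
    then show ?thesis
      using 2 by (simp add: tau_degree_def gen_def matrix_mult_mat_left_commute)
  next
    case False
    then have "word_mat ((b, k) # w) = mat (unif ^ k) ** (mpow tau_u k ** (mat (unif ^ tau_degree w) ** uword w))"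
      using 2 by (simp add: mpow_tau3 matrix_mul_assoc)
    then show ?thesis
      using False by (simp add: tau_degree_def gen_def mat_mult_collect_mat power_add)
  qed
qed (simp add: tau_degree_def)

definition Lambda_u :: "cmat set" where
  "Lambda_u = range uword"

lemma uword_in_Lambda_u: "uword w \<in> Lambda_u"
  by (simp add: Lambda_u_def)

lemma Lambda_u_mult: "U \<in> Lambda_u \<Longrightarrow> V \<in> Lambda_u \<Longrightarrow> U ** V \<in> Lambda_u"
  by (auto simp: Lambda_u_def uword_append[symmetric])

lemma unitary_Lambda_u: "U \<in> Lambda_u \<Longrightarrow> unitary U"
  by (auto simp: Lambda_u_def unitary_uword)

lemma mstar_mpow_gen: "mstar (mpow (gen b) k) = mpow (gen b) (2 * k)"
proof -
  have "mpow (gen b) (2 * k) ** mpow (gen b) k = mpow (gen b) (3 * k)"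
    by (simp add: mpow_add[symmetric])
  also have "\<dots> = mat 1" using mpow_mod_order[OF gen_cube, of b "3 * k"] by simp
  finally show ?thesis
    by (rule unitary_left_inverse[OF unitary_mpow[OF unitary_gen], symmetric])
qed

lemma Lambda_u_mstar: "U \<in> Lambda_u \<Longrightarrow> mstar U \<in> Lambda_u"
proof -
  have "mstar (uword w) \<in> Lambda_u" for w
  proof (induct w rule: uword.induct)
    case (2 b k w)
    have "mstar (uword ((b, k) # w)) = mstar (uword w) ** uword [(b, 2 * k)]"
      by (simp add: mstar_mult mstar_mpow_gen)
    then show ?case using 2 Lambda_u_mult uword_in_Lambda_u by metis
  qed (simp add: mstar_mat uword_in_Lambda_u[of "[]", simplified])
  then show "U \<in> Lambda_u \<Longrightarrow> mstar U \<in> Lambda_u" by (auto simp: Lambda_u_def)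
qed

lemma alt_word_Cons: "alt_word (l # w) \<longleftrightarrow>
    snd l \<in> {1, 2} \<and> alt_word w \<and> (w \<noteq> [] \<longrightarrow> fst l \<noteq> fst (hd w))"
proof
  assume a: "alt_word (l # w)"
  have "\<forall>i. Suc i < length w \<longrightarrow> fst (w ! i) \<noteq> fst (w ! Suc i)"
    using a unfolding alt_word_def by (metis Suc_less_eq length_Cons nth_Cons_Suc)
  moreover have "w \<noteq> [] \<longrightarrow> fst l \<noteq> fst (hd w)" using a unfolding alt_word_def
    by (metis hd_conv_nth length_Cons length_greater_0_conv not_less_eq nth_Cons_0 nth_Cons_Suc)
  ultimately show "snd l \<in> {1, 2} \<and> alt_word w \<and> (w \<noteq> [] \<longrightarrow> fst l \<noteq> fst (hd w))"
    using a by (simp add: alt_word_def)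
next
  assume a: "snd l \<in> {1, 2} \<and> alt_word w \<and> (w \<noteq> [] \<longrightarrow> fst l \<noteq> fst (hd w))"
  have "fst ((l # w) ! i) \<noteq> fst ((l # w) ! Suc i)" if "Suc i < length (l # w)" for i
    using a that by (cases i) (simp_all add: hd_conv_nth alt_word_def)
  then show "alt_word (l # w)" using a by (auto simp: alt_word_def)
qed

fun push :: "bool \<times> nat \<Rightarrow> (bool \<times> nat) list \<Rightarrow> (bool \<times> nat) list" where
  "push (b, k) [] = (if k mod 3 = 0 then [] else [(b, k mod 3)])"
| "push (b, k) ((b', k') # w) =
    (if k mod 3 = 0 then (b', k') # w
     else if b = b' then (if (k + k') mod 3 = 0 then w else (b, (k + k') mod 3) # w)
     else (b, k mod 3) # (b', k') # w)"

lemma uword_push: "uword (push (b, k) w) = mpow (gen b) k ** uword w"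
proof (cases w)
  case Nil
  then show ?thesis using mpow_mod_order[OF gen_cube, of b k] by auto
next
  case (Cons l w')
  obtain b' k' where l: "l = (b', k')" by (cases l)
  have "mpow (gen b) k ** uword w = mpow (gen b) ((k + k') mod 3) ** uword w'" if "b = b'"
    using that mpow_mod_order[OF gen_cube, of b "k + k'"]
    by (simp add: Cons l mpow_add matrix_mul_assoc)
  then show ?thesis using mpow_mod_order[OF gen_cube, of b k] by (auto simp: Cons l)
qed

lemma alt_word_push: "alt_word w \<Longrightarrow> alt_word (push (b, k) w)"
proof (cases w)
  case Nil
  then show ?thesis by (auto simp: alt_word_Cons alt_word_def)
next
  case (Cons l w')
  assume "alt_word w"
  moreover obtain b' k' where l: "l = (b', k')" by (cases l)
  ultimately show ?thesis using Cons by (auto simp: alt_word_Cons)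
qed

lemma Lambda_u_alt_word:
  assumes "U \<in> Lambda_u"
  obtains w where "alt_word w" "U = uword w"
proof -
  have "\<exists>v. alt_word v \<and> uword v = uword w" for w
  proof (induct w rule: uword.induct)
    case 1
    then show ?case by (intro exI[of _ "[]"]) (simp add: alt_word_def)
  next
    case (2 b k w)
    then obtain v where "alt_word v" "uword v = uword w" by blast
    then show ?case by (intro exI[of _ "push (b, k) v"]) (simp add: alt_word_push uword_push)
  qed
  moreover obtain x where "U = uword x" using assms by (auto simp: Lambda_u_def)
  ultimately show ?thesis using that by metis
qed

lemma Lam2_generator_scalar_gen:
  assumes "x \<in> {sigma3, tau3, matrix_inv sigma3, matrix_inv tau3}"
  obtains c b k where "unitDg c" "x = mat c ** mpow (gen b) k"
proof -
  have "sigma3 = mat 1 ** mpow (gen True) 1" "matrix_inv sigma3 = mat 1 ** mpow (gen True) 2"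
    "matrix_inv tau3 = mat (inverse unif) ** mpow (gen False) 2"
    by (simp_all add: gen_def matrix_inv_sigma3 matrix_inv_tau3 mpow_2)
  moreover have "tau3 = mat unif ** mpow (gen False) 1"
    by (simp add: gen_def tau3_eq)
  ultimately show ?thesis
    using assms that unitDg_1 unitDg_unif unitDg_inverse[OF unitDg_unif] by (elim insertE emptyE) metis+
qed

lemma word_mat_in_Lam2: "word_mat w \<in> Lam2"
proof -
  define ws where "ws = concat (map (\<lambda>(b, k). replicate k (if b then sigma3 else tau3)) w)"
  have rep: "foldr (**) (replicate k X) Y = mpow X k ** Y" for k X and Y :: cmat
    by (induct k) (simp_all add: matrix_mul_assoc del: foldr_replicate)
  have "foldr (**) ws (mat 1) = word_mat w"
    unfolding ws_def by (induct w rule: word_mat.induct) (simp_all add: rep del: foldr_replicate)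
  moreover have "set ws \<subseteq> {sigma3, tau3, matrix_inv sigma3, matrix_inv tau3}"
    by (auto simp: ws_def split: if_splits)
  ultimately show ?thesis
    unfolding Lam2_def by (intro CollectI exI[of _ 1] exI[of _ ws]) (simp add: unitDg_1)
qed

lemma foldr_Lam2_generators:
  assumes "set ws \<subseteq> {sigma3, tau3, matrix_inv sigma3, matrix_inv tau3}"
  obtains \<xi> U where "unitDg \<xi>" "U \<in> Lambda_u" "foldr (**) ws (mat 1) = mat \<xi> ** U"
proof -
  have "\<exists>\<xi> U. unitDg \<xi> \<and> U \<in> Lambda_u \<and> foldr (**) ws (mat 1) = mat \<xi> ** U" using assms
  proof (induct ws)
    case Nil
    then show ?case using unitDg_1 uword_in_Lambda_u[of "[]"] by fastforce
  next
    case (Cons x ws)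
    then obtain \<xi> U where "unitDg \<xi>" "U \<in> Lambda_u" "foldr (**) ws (mat 1) = mat \<xi> ** U" by auto
    moreover have "x \<in> {sigma3, tau3, matrix_inv sigma3, matrix_inv tau3}" using Cons.prems by simp
    then obtain c b k where "unitDg c" "x = mat c ** mpow (gen b) k" by (rule Lam2_generator_scalar_gen)
    moreover have "mpow (gen b) k ** U \<in> Lambda_u"
      using Lambda_u_mult[OF uword_in_Lambda_u[of "[(b, k)]"] \<open>U \<in> Lambda_u\<close>] by simp
    ultimately show ?case
      by (intro exI[of _ "c * \<xi>"] exI[of _ "mpow (gen b) k ** U"])
        (simp add: unitDg_mult mat_mult_collect_mat flip: matrix_mul_assoc)
  qed
  then show ?thesis using that by blast
qed

lemma Lam2_eq: "Lam2 = {mat \<xi> ** U | \<xi> U. unitDg \<xi> \<and> U \<in> Lambda_u}"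
proof (intro equalityI subsetI)
  fix g assume "g \<in> Lam2"
  then obtain u ws where g: "g = mat u ** foldr (**) ws (mat 1)" and u: "unitDg u"
    and ws: "set ws \<subseteq> {sigma3, tau3, matrix_inv sigma3, matrix_inv tau3}"
    by (auto simp: Lam2_def)
  obtain \<xi> U where "unitDg \<xi>" "U \<in> Lambda_u" "foldr (**) ws (mat 1) = mat \<xi> ** U"
    using foldr_Lam2_generators[OF ws] .
  then have "unitDg (u * \<xi>)" "U \<in> Lambda_u" "g = mat (u * \<xi>) ** U"
    using g u by (simp_all add: unitDg_mult mat_mult_mat matrix_mul_assoc)
  then show "g \<in> {mat \<xi> ** U | \<xi> U. unitDg \<xi> \<and> U \<in> Lambda_u}" by blast
next
  fix g assume "g \<in> {mat \<xi> ** U | \<xi> U. unitDg \<xi> \<and> U \<in> Lambda_u}"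
  then obtain \<xi> w where \<xi>: "unitDg \<xi>" and g: "g = mat \<xi> ** uword w" by (auto simp: Lambda_u_def)
  define c where "c = \<xi> * inverse (unif ^ tau_degree w)"
  have "c * unif ^ tau_degree w = \<xi>" by (simp add: c_def unif_def)
  then have "g = mat c ** word_mat w"
    by (simp add: g word_mat_eq_uword matrix_mul_assoc mat_mult_mat)
  moreover have "unitDg c"
    by (simp add: c_def \<xi> unitDg_mult unitDg_inverse unitDg_power unitDg_unif)
  ultimately show "g \<in> Lam2"
    using word_mat_in_Lam2[of w] unfolding Lam2_def
    by (auto simp: matrix_mul_assoc mat_mult_mat) (metis unitDg_mult)
qed

section \<open>Ping-pong\<close>

definition red_vec :: "cvec \<Rightarrow> bool \<times> bool \<times> bool" where
  "red_vec x = (red_pi (x$1), red_pi (x$2), red_pi (x$3))"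

lemma Ovec_iff: "x \<in> Ovec \<longleftrightarrow> x$1 \<in> Gint \<and> x$2 \<in> Gint \<and> x$3 \<in> Gint"
  by (auto simp: Ovec_def forall_3)

lemma vector_in_Ovec [simp]: "vector [a, b, c] \<in> Ovec \<longleftrightarrow> a \<in> Gint \<and> b \<in> Gint \<and> c \<in> Gint"
  by (simp add: Ovec_iff)

lemma red_vec_vector [simp]: "red_vec (vector [a, b, c]) = (red_pi a, red_pi b, red_pi c)"
  by (simp add: red_vec_def)

definition pingpong_A :: "nat \<Rightarrow> cvec set" where
  "pingpong_A j = {inverse unif ^ j *s y | y.
     y \<in> Ovec \<and> red_vec y \<in> {(True, False, True), (False, True, True)}}"

definition pingpong_B :: "nat \<Rightarrow> cvec set" where
  "pingpong_B j = {inverse unif ^ j *s y | y. y \<in> Ovec \<and> red_vec y = (True, True, False)}"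

lemma mpow_1_2: "k \<in> {1, 2} \<Longrightarrow> mpow g k = g \<or> mpow g k = g ** g"
  by (auto simp: mpow_2)

lemma sigma3_pingpong:
  assumes "k \<in> {1, 2}" "x \<in> pingpong_B j"
  shows "mpow sigma3 k *v x \<in> pingpong_A j"
proof -
  obtain y where y: "y \<in> Ovec" "x = inverse unif ^ j *s y" "red_vec y = (True, True, False)"
    using assms(2) by (auto simp: pingpong_B_def)
  have "sigma3 *v x = inverse unif ^ j *s vector [y$2, y$3, y$1]"
    "(sigma3 ** sigma3) *v x = inverse unif ^ j *s vector [y$3, y$1, y$2]"
    using y by (simp_all add: vector_scalar_commute sigma3_mult_vec)
  then show ?thesis using y mpow_1_2[OF assms(1), of sigma3] unfolding pingpong_A_def
    by (auto simp: Ovec_iff red_vec_def)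
qed

lemma tau_u_pingpong:
  assumes "k \<in> {1, 2}" "x \<in> pingpong_A j"
  shows "mpow tau_u k *v x \<in> pingpong_B (Suc j)"
proof -
  obtain y where y: "y \<in> Ovec" "x = inverse unif ^ j *s y"
    and p: "red_vec y \<in> {(True, False, True), (False, True, True)}"
    using assms(2) by (auto simp: pingpong_A_def)
  have g: "y$1 \<in> Gint" "y$2 \<in> Gint" "y$3 \<in> Gint" using y by (auto simp: Ovec_iff)
  have pp: "red_pi (y$1) \<noteq> red_pi (y$2)" using p by (auto simp: red_vec_def)
  define z1 :: cvec where "z1 = vector [y$2 - y$1, \<i> * (y$1 + y$2), unif * y$3]"
  define z2 :: cvec where "z2 = vector [\<i> * y$1 - y$2, - \<i> * y$1 - y$2, unif * y$3]"
  have "tau_u *v x = inverse unif ^ Suc j *s z1" "(tau_u ** tau_u) *v x = inverse unif ^ Suc j *s z2"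
    by (simp_all add: y z1_def z2_def tau_u_mult_vec vector_scalar_commute mult.commute)
  moreover have "z1 \<in> Ovec" "z2 \<in> Ovec" "red_vec z1 = (True, True, False)" "red_vec z2 = (True, True, False)"
    using pp g by (simp_all add: z1_def z2_def red_pi_arith red_pi_uminus_cnj)
  ultimately show ?thesis
    using mpow_1_2[OF assms(1), of tau_u] unfolding pingpong_B_def by auto
qed

definition tau_letters :: "(bool \<times> nat) list \<Rightarrow> nat" where
  "tau_letters w = length (filter (\<lambda>l. \<not> fst l) w)"

lemma pingpong:
  "alt_word w \<Longrightarrow> w \<noteq> [] \<Longrightarrow> x \<in> (if fst (last w) then pingpong_B j else pingpong_A j) \<Longrightarrow>
    uword w *v x \<in> (if fst (hd w) then pingpong_A (j + tau_letters w) else pingpong_B (j + tau_letters w))"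
proof (induct w arbitrary: x)
  case (Cons l w)
  obtain b k where l: "l = (b, k)" by (cases l)
  have k: "k \<in> {1, 2}" and aw: "alt_word w" and hd: "w \<noteq> [] \<longrightarrow> b \<noteq> fst (hd w)"
    using Cons.prems(1) l by (auto simp: alt_word_Cons)
  have step: "mpow (gen b) k *v y \<in> (if b then pingpong_A i else pingpong_B (Suc i))"
    if "y \<in> (if b then pingpong_B i else pingpong_A i)" for y i
    using that sigma3_pingpong[OF k] tau_u_pingpong[OF k] by (auto simp: gen_def)
  have "uword w *v x \<in> (if b then pingpong_B (j + tau_letters w) else pingpong_A (j + tau_letters w))"
  proof (cases "w = []")
    case True
    then show ?thesis using Cons.prems(3) by (simp add: l tau_letters_def split: if_splits)
  next
    case False
    then show ?thesis using Cons.hyps[OF aw False] Cons.prems(3) hd by (auto simp: l)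
  qed
  then show ?case
    using step[of "uword w *v x"] by (auto simp: l tau_letters_def matrix_vector_mul_assoc)
qed simp

lemma pingpong_not_integral:
  assumes "j \<ge> 1" "x \<in> pingpong_A j \<union> pingpong_B j"
  shows "x \<notin> Ovec"
proof
  assume x: "x \<in> Ovec"
  obtain y where y: "x = inverse unif ^ j *s y" and p: "red_pi (y$1) \<or> red_pi (y$2) \<or> red_pi (y$3)"
    using assms(2) by (auto simp: pingpong_A_def pingpong_B_def red_vec_def)
  have "unif ^ j * inverse unif ^ j = 1"
    by (simp add: unif_def power_mult_distrib[symmetric] complex_eq_iff)
  then have "y = unif ^ j *s x" by (simp add: y)
  also obtain j' where "j = Suc j'" using assms(1) by (cases j) auto
  then have "unif ^ j *s x = unif *s (unif ^ j' *s x)" by simp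
  finally have "y = unif *s (unif ^ j' *s x)" .
  then have "\<not> red_pi (y$i)" for i
    using x by (simp add: Ovec_def red_pi_arith)
  then show False using p by blast
qed

lemma alt_word_moves_Ovec:
  assumes "alt_word w" "w \<noteq> []" "\<nexists>k. w = [(True, k)]"
  obtains x where "x \<in> Ovec" "uword w *v x \<notin> Ovec"
proof -
  obtain l w' where w: "w = l # w'" using assms(2) by (cases w) auto
  have "tau_letters w \<noteq> 0"
  proof
    assume "tau_letters w = 0"
    then have all: "\<forall>x\<in>set w. fst x" by (auto simp: tau_letters_def filter_empty_conv)
    then have "w' = []" using assms(1) w by (auto simp: alt_word_Cons)
    then show False using assms(3) all w by (cases l) auto
  qed
  define x :: cvec where "x = (if fst (last w) then vector [1, 1, 0] else vector [1, 0, 1])"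
  have "x \<in> (if fst (last w) then pingpong_B 0 else pingpong_A 0)"
    by (auto simp: x_def pingpong_A_def pingpong_B_def intro!: exI[of _ x])
  from pingpong[OF assms(1,2) this]
  have "uword w *v x \<in> pingpong_A (tau_letters w) \<union> pingpong_B (tau_letters w)"
    by (simp split: if_splits)
  then have "uword w *v x \<notin> Ovec"
    using pingpong_not_integral \<open>tau_letters w \<noteq> 0\<close> by (simp add: Suc_le_eq)
  moreover have "x \<in> Ovec" by (simp add: x_def)
  ultimately show ?thesis using that by blast
qed

section \<open>The stabiliser of the standard edge\<close>

text \<open>\<open>(Ovec, M_std)\<close> is the standard edge: \<open>M_std / unif Ovec\<close> is the isotropic line of
  \<open>F\<^sub>2\<^sup>3\<close> spanned by \<open>(1, 1, 0)\<close>.\<close>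

definition M_std :: "cvec set" where
  "M_std = {x \<in> Ovec. red_pi (x$1) = red_pi (x$2) \<and> \<not> red_pi (x$3)}"

lemma alt_word_single_sigma: "alt_word [(True, k)] \<Longrightarrow> k \<in> {1, 2}"
  by (simp add: alt_word_def)

lemma Lambda_u_stabilizer_std_edge:
  assumes "U \<in> Lambda_u" "(*v) U ` Ovec \<subseteq> Ovec" "(*v) U ` M_std \<subseteq> M_std"
  shows "U = mat 1"
proof -
  obtain w where w: "alt_word w" "U = uword w" using assms(1) by (rule Lambda_u_alt_word)
  show ?thesis
  proof (cases "w = []")
    case False
    then show ?thesis
    proof (cases "\<exists>k. w = [(True, k)]")
      case False
      then obtain x where "x \<in> Ovec" "uword w *v x \<notin> Ovec"
        by (rule alt_word_moves_Ovec[OF w(1) \<open>w \<noteq> []\<close>])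
      then show ?thesis using assms(2) w(2) by blast
    next
      case True
      then obtain k where k: "w = [(True, k)]" "k \<in> {1, 2}" using w(1) alt_word_single_sigma by blast
      have "vector [1, 1, 0] \<in> M_std" by (simp add: M_std_def)
      moreover have "mpow sigma3 k *v vector [1, 1, 0] \<notin> M_std"
        using k by (auto simp: M_std_def mpow_2 sigma3_mult_vec)
      ultimately show ?thesis using assms(3) k w(2) by (auto simp: gen_def)
    qed
  qed (simp add: w)
qed

lemma alt_uword_not_scalar:
  assumes "alt_word w" "w \<noteq> []" "\<zeta> \<in> Gint"
  shows "uword w \<noteq> mat \<zeta>"
proof
  assume e: "uword w = mat \<zeta>"
  show False
  proof (cases "\<exists>k. w = [(True, k)]")
    case False
    then obtain x where "x \<in> Ovec" "uword w *v x \<notin> Ovec"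
      by (rule alt_word_moves_Ovec[OF assms(1,2)])
    then show False using assms(3) by (simp add: e mat_matrix_vector_mult Ovec_def)
  next
    case True
    then obtain k where k: "w = [(True, k)]" "k \<in> {1, 2}" using assms(1) alt_word_single_sigma by blast
    then have "mpow sigma3 k $ 1 $ 2 = 0 \<and> mpow sigma3 k $ 1 $ 3 = 0"
      using e by (simp add: gen_def mat_nth)
    then show False using k by (auto simp: mpow_2 matrix_mult_nth3 sigma3_def)
  qed
qed

section \<open>Lattices\<close>

definition gi_module :: "cvec set \<Rightarrow> bool" where
  "gi_module L \<longleftrightarrow> (\<forall>x\<in>L. \<forall>y\<in>L. x + y \<in> L) \<and> (\<forall>a\<in>Gint. \<forall>x\<in>L. a *s x \<in> L)"

lemma gi_moduleI:
  assumes "\<And>x y. x \<in> L \<Longrightarrow> y \<in> L \<Longrightarrow> x + y \<in> L" "\<And>a x. a \<in> Gint \<Longrightarrow> x \<in> L \<Longrightarrow> a *s x \<in> L"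
  shows "gi_module L"
  using assms by (simp add: gi_module_def)

lemma is_lattice_gi_module: "is_lattice L \<Longrightarrow> gi_module L"
  by (simp add: is_lattice_def gi_module_def)

lemma gi_module_diff:
  assumes "gi_module L" "x \<in> L" "y \<in> L"
  shows "x - y \<in> L"
proof -
  have "x + (- 1) *s y \<in> L" using assms unfolding gi_module_def by (metis Gint_closed(4) Gint_consts(2))
  then show ?thesis by (simp add: vec_eq_iff)
qed

lemma gi_module_image: "gi_module L \<Longrightarrow> gi_module ((*v) (A::cmat) ` L)"
  unfolding gi_module_def
  by (auto simp: matrix_vector_right_distrib[symmetric] vector_scalar_commute[symmetric])

lemma gi_module_Ovec: "gi_module Ovec"
  by (simp add: gi_module_def Ovec_def)

lemma gi_module_M_std: "gi_module M_std"
  unfolding gi_module_def M_std_def by (auto simp: Ovec_iff red_pi_arith)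

lemma gi_module_scaleset:
  assumes "gi_module L"
  shows "gi_module (scaleset c L)"
proof (rule gi_moduleI)
  fix x y assume "x \<in> scaleset c L" "y \<in> scaleset c L"
  then obtain x' y' where "x' \<in> L" "y' \<in> L" "x = c *s x'" "y = c *s y'" by (auto simp: scaleset_def)
  then have "x + y = c *s (x' + y')" by simp
  moreover have "x' + y' \<in> L" using assms \<open>x' \<in> L\<close> \<open>y' \<in> L\<close> by (simp add: gi_module_def)
  ultimately show "x + y \<in> scaleset c L" unfolding scaleset_def by (rule image_eqI)
next
  fix a x assume "a \<in> Gint" "x \<in> scaleset c L"
  then obtain x' where "x' \<in> L" "x = c *s x'" by (auto simp: scaleset_def)
  then have "a *s x = c *s (a *s x')" by (simp add: mult.commute)
  moreover have "a *s x' \<in> L" using assms \<open>a \<in> Gint\<close> \<open>x' \<in> L\<close> by (simp add: gi_module_def)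
  ultimately show "a *s x \<in> scaleset c L" unfolding scaleset_def by (rule image_eqI)
qed

lemma scaleset_subset_iff: "scaleset c L \<subseteq> A \<longleftrightarrow> (\<forall>x\<in>L. c *s x \<in> A)"
  by (auto simp: scaleset_def)

lemma scaleset_image: "scaleset c ((*v) (A::cmat) ` L) = (*v) A ` scaleset c L"
  by (auto simp: scaleset_def image_image vector_scalar_commute)

lemma dual_image_unitary:
  assumes "unitary U"
  shows "dual ((*v) U ` L) = (*v) U ` dual L"
proof -
  have "y \<in> dual ((*v) U ` L) \<longleftrightarrow> y \<in> (*v) U ` dual L" for y
    unfolding unitary_image_iff[OF assms] dual_def by (simp add: hform_adjoint)
  then show ?thesis by blast
qed

lemma dual_antimono: "A \<subseteq> B \<Longrightarrow> dual B \<subseteq> dual A"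
  by (auto simp: dual_def)

lemma dual_Ovec: "dual Ovec = Ovec"
proof
  show "Ovec \<subseteq> dual Ovec" by (auto simp: dual_def hform3 Ovec_iff)
  show "dual Ovec \<subseteq> Ovec"
  proof
    fix y assume "y \<in> dual Ovec"
    then have "hform (vector [1, 0, 0]) y \<in> Gint" "hform (vector [0, 1, 0]) y \<in> Gint"
      "hform (vector [0, 0, 1]) y \<in> Gint"
      unfolding dual_def by (simp_all add: Ovec_iff)
    then have "cnj (y$1) \<in> Gint" "cnj (y$2) \<in> Gint" "cnj (y$3) \<in> Gint"
      by (simp_all add: hform3)
    then show "y \<in> Ovec" by (metis Ovec_iff Gint_closed(5) complex_cnj_cnj)
  qed
qed

lemma is_lattice_bounded: "is_lattice L \<Longrightarrow> \<exists>n. scaleset (unif ^ n) L \<subseteq> Ovec"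
proof -
  assume "is_lattice L"
  then obtain m where m: "L \<subseteq> scaleset (1 / 2 ^ m) Ovec" by (auto simp: is_lattice_def)
  have "unif ^ (2 * m) * (1 / 2 ^ m) = (- \<i>) ^ m"
  proof -
    have "unif\<^sup>2 = - \<i> * 2" by (simp add: unif_def power2_eq_square complex_eq_iff)
    then have "unif ^ (2 * m) = (- \<i>) ^ m * 2 ^ m"
      by (simp only: power_mult power_mult_distrib)
    then show ?thesis by simp
  qed
  moreover have "(- \<i>) ^ m *s z \<in> Ovec" if "z \<in> Ovec" for z
    using that by (simp add: Ovec_def)
  ultimately have "unif ^ (2 * m) *s x \<in> Ovec" if "x \<in> L" for x
    using m that by (auto simp: scaleset_def)
  then show ?thesis by (auto simp: scaleset_subset_iff)
qed

lemma sigma3_mult_Ovec: "x \<in> Ovec \<Longrightarrow> mpow sigma3 a *v x \<in> Ovec"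
  by (induct a) (simp_all add: Ovec_iff sigma3_mult_vec flip: matrix_vector_mul_assoc)

lemma sigma3_image_Ovec: "(*v) (mpow sigma3 a) ` Ovec = Ovec"
proof -
  have "mpow sigma3 a ** mpow sigma3 (2 * a) = mat 1"
    using mpow_mod_order[OF sigma3_cube, of "3 * a"] by (simp add: mpow_add[symmetric])
  then have "x = mpow sigma3 a *v (mpow sigma3 (2 * a) *v x)" for x
    by (simp add: matrix_vector_mul_assoc)
  then show ?thesis using sigma3_mult_Ovec by blast
qed

lemma scaleset_unif_Ovec_iff:
  "x \<in> scaleset unif Ovec \<longleftrightarrow> x \<in> Ovec \<and> red_vec x = (False, False, False)"
proof
  assume "x \<in> scaleset unif Ovec"
  then obtain z where "z \<in> Ovec" "x = unif *s z" by (auto simp: scaleset_def)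
  then show "x \<in> Ovec \<and> red_vec x = (False, False, False)"
    by (simp add: Ovec_iff red_vec_def red_pi_arith)
next
  assume "x \<in> Ovec \<and> red_vec x = (False, False, False)"
  then have "x$1 \<in> Gint" "x$2 \<in> Gint" "x$3 \<in> Gint"
    "\<not> red_pi (x$1)" "\<not> red_pi (x$2)" "\<not> red_pi (x$3)"
    by (simp_all add: Ovec_iff red_vec_def)
  then obtain z1 z2 z3 where "z1 \<in> Gint" "z2 \<in> Gint" "z3 \<in> Gint"
    "x$1 = unif * z1" "x$2 = unif * z2" "x$3 = unif * z3"
    using not_red_pi_iff_dvd by meson
  then have "vector [z1, z2, z3] \<in> Ovec" "x = unif *s vector [z1, z2, z3]"
    by (simp_all add: vec_eq3)
  then show "x \<in> scaleset unif Ovec" by (auto simp: scaleset_def)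
qed

lemma red_pi_hform:
  assumes "x \<in> Ovec" "y \<in> Ovec"
  shows "red_pi (hform x y) \<longleftrightarrow>
    ((red_pi (x$1) \<and> red_pi (y$1)) \<noteq> ((red_pi (x$2) \<and> red_pi (y$2)) \<noteq> (red_pi (x$3) \<and> red_pi (y$3))))"
  using assms by (simp add: hform3 Ovec_iff red_pi_arith red_pi_uminus_cnj) blast

text \<open>No two of the nonzero isotropic vectors \<open>(1,1,0), (1,0,1), (0,1,1)\<close> of \<open>F\<^sub>2\<^sup>3\<close> are
  orthogonal.\<close>

lemma red_vec_isotropic_orthogonal:
  assumes "x \<in> Ovec" "y \<in> Ovec" "\<not> red_pi (hform x x)" "\<not> red_pi (hform x y)"
    "\<not> red_pi (hform y y)" "red_vec y \<noteq> (False, False, False)"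
  shows "red_vec x = (False, False, False) \<or> red_vec x = red_vec y"
  using assms(3-6) red_pi_hform[OF assms(1,1)] red_pi_hform[OF assms(1,2)] red_pi_hform[OF assms(2,2)]
  unfolding red_vec_def by auto

lemma red_vec_isotropic_sigma3:
  assumes "x \<in> Ovec" "\<not> red_pi (hform x x)" "red_vec x \<noteq> (False, False, False)"
  obtains a where "red_vec (mpow sigma3 a *v x) = (True, True, False)"
proof -
  have rot: "red_vec (mpow sigma3 0 *v x) = red_vec x"
    "red_vec (mpow sigma3 1 *v x) = (red_pi (x$2), red_pi (x$3), red_pi (x$1))"
    "red_vec (mpow sigma3 2 *v x) = (red_pi (x$3), red_pi (x$1), red_pi (x$2))"
    by (simp_all add: mpow_2 sigma3_mult_vec red_vec_def)
  have "red_vec x = (True, True, False) \<or> (red_pi (x$3), red_pi (x$1), red_pi (x$2)) = (True, True, False)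
      \<or> (red_pi (x$2), red_pi (x$3), red_pi (x$1)) = (True, True, False)"
    using assms(2,3) red_pi_hform[OF assms(1,1)] unfolding red_vec_def by auto
  then show ?thesis using that rot by metis
qed

section \<open>Vertices: self-dual lattices\<close>

text \<open>For integral \<open>y\<close> with \<open>unif\<close> dividing \<open>y$3\<close>, \<open>\<tau>'\<^sup>j y\<close> lies in \<open>unif Ovec\<close> iff \<open>2\<close> divides
  \<open>tau_form j y\<close> (\<open>j = 1, 2\<close>).\<close>

definition tau_form :: "nat \<Rightarrow> cvec \<Rightarrow> complex" where
  "tau_form j y = (if j = 1 then y$2 - y$1 else \<i> * y$1 - y$2)"

lemma tau_form_diff: "tau_form j (x - y) = tau_form j x - tau_form j y"
  by (simp add: tau_form_def algebra_simps)

lemma tau_u_mult_in_unif_Ovec: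
  assumes "j \<in> {1, 2}" "y \<in> Ovec" "\<not> red_pi (y$3)" "two_dvd (tau_form j y)"
  shows "mpow tau_u j *v y \<in> scaleset unif Ovec"
proof -
  obtain w where w: "w \<in> Gint" "tau_form j y = 2 * w" using assms(4) by (auto simp: two_dvd_def)
  obtain w3 where w3: "w3 \<in> Gint" "y$3 = unif * w3"
    using assms(2,3) not_red_pi_iff_dvd Ovec_iff by blast
  have y1: "y$1 \<in> Gint" using assms(2) by (simp add: Ovec_iff)
  consider "j = 1" "y$2 = y$1 + 2 * w" | "j = 2" "y$2 = \<i> * y$1 - 2 * w"
    using assms(1) w(2) by (auto simp: tau_form_def algebra_simps)
  then have "\<exists>z\<in>Ovec. mpow tau_u j *v y = unif *s z"
  proof cases
    case 1
    have "tau_u *v y = unif *s vector [\<i> * w, - (w + y$1), w3]"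
      unfolding tau_u_mult_vec inverse_unif
      by (simp add: vec_eq3 1 w3(2) unif_def field_simps complex_eq_iff)
    then show ?thesis using 1 w w3 y1 by (intro bexI[of _ "vector [\<i> * w, - (w + y$1), w3]"]) simp_all
  next
    case 2
    have "(tau_u ** tau_u) *v y = unif *s vector [\<i> * w, y$1 + \<i> * w, w3]"
      unfolding tau_u_mult_vec inverse_unif
      by (simp add: vec_eq3 2 w3(2) unif_def field_simps complex_eq_iff)
    then show ?thesis using 2 w w3 y1
      by (intro bexI[of _ "vector [\<i> * w, y$1 + \<i> * w, w3]"]) (simp_all add: mpow_2)
  qed
  then show ?thesis by (auto simp: scaleset_def)
qed

lemma two_dvd_tau_form_orthogonal:
  assumes "y \<in> Ovec" "red_vec y = (False, False, False)"
    and "y0 \<in> Ovec" "red_vec y0 = (True, True, False)" "two_dvd (hform y y0)"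
  shows "two_dvd (tau_form j y)"
proof -
  obtain a1 b1 a2 b2 a3 b3 where y: "y$1 = gauss a1 b1" "y$2 = gauss a2 b2" "y$3 = gauss a3 b3"
    using assms(1) by (metis GintE Ovec_iff)
  obtain c1 d1 c2 d2 c3 d3 where y0: "y0$1 = gauss c1 d1" "y0$2 = gauss c2 d2" "y0$3 = gauss c3 d3"
    using assms(3) by (metis GintE Ovec_iff)
  have p: "even (a1 + b1)" "even (a2 + b2)" "even (a3 + b3)"
      "odd (c1 + d1)" "odd (c2 + d2)" "even (c3 + d3)"
    using assms(2,4) by (simp_all add: red_vec_def y y0)
  have "hform y y0 = gauss (a1*c1 + b1*d1 + (a2*c2 + b2*d2) + (a3*c3 + b3*d3))
      (b1*c1 - a1*d1 + (b2*c2 - a2*d2) + (b3*c3 - a3*d3))"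
    by (simp add: hform3 y y0 gauss_arith)
  then have e: "even (a1*c1 + b1*d1 + (a2*c2 + b2*d2) + (a3*c3 + b3*d3))"
      "even (b1*c1 - a1*d1 + (b2*c2 - a2*d2) + (b3*c3 - a3*d3))"
    using assms(5) by (simp_all add: two_dvd_gauss)
  have "tau_form j y = gauss (a2 - a1) (b2 - b1) \<or> tau_form j y = gauss (- b1 - a2) (a1 - b2)"
    by (simp add: tau_form_def y gauss_consts(3) gauss_arith)
  moreover have "even (a2 - a1) \<and> even (b2 - b1) \<and> even (- b1 - a2) \<and> even (a1 - b2)"
    using p e by simp presburger
  ultimately show ?thesis by (auto simp: two_dvd_gauss)
qed

lemma two_dvd_tau_form_exists:
  assumes "y0 \<in> Ovec" "red_vec y0 = (True, True, False)"
  obtains j where "j \<in> {1, 2}" "two_dvd (tau_form j y0)"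
proof -
  obtain a1 b1 a2 b2 where y: "y0$1 = gauss a1 b1" "y0$2 = gauss a2 b2"
    using assms(1) by (metis GintE Ovec_iff)
  have "odd (a1 + b1)" "odd (a2 + b2)" using assms(2) by (simp_all add: red_vec_def y)
  then have "(even (a2 - a1) \<and> even (b2 - b1)) \<or> (even (- b1 - a2) \<and> even (a1 - b2))"
    by presburger
  moreover have "tau_form 1 y0 = gauss (a2 - a1) (b2 - b1)" "tau_form 2 y0 = gauss (- b1 - a2) (a1 - b2)"
    by (simp_all add: tau_form_def y gauss_consts(3) gauss_arith)
  ultimately have "two_dvd (tau_form 1 y0) \<or> two_dvd (tau_form 2 y0)" by (simp add: two_dvd_gauss)
  then show ?thesis using that by blast
qed

lemma tau_u_contracts:
  assumes K: "gi_module K" "K \<subseteq> Ovec" "\<forall>x\<in>K. \<forall>y\<in>K. two_dvd (hform x y)"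
    and y0: "y0 \<in> K" "red_vec y0 = (True, True, False)"
  obtains j where "j \<in> {1, 2}" "\<forall>y\<in>K. mpow tau_u j *v y \<in> scaleset unif Ovec"
proof -
  have y0O: "y0 \<in> Ovec" using K(2) y0(1) by blast
  obtain j where j: "j \<in> {1, 2}" "two_dvd (tau_form j y0)"
    using two_dvd_tau_form_exists[OF y0O y0(2)] by blast
  have "mpow tau_u j *v y \<in> scaleset unif Ovec" if y: "y \<in> K" for y
  proof -
    have yO: "y \<in> Ovec" using K(2) y by blast
    have red: "red_vec y = (False, False, False) \<or> red_vec y = (True, True, False)"
      using red_vec_isotropic_orthogonal[OF yO y0O] K(3) y y0 two_dvd_imp_not_red_pi by auto
    have "two_dvd (tau_form j y)"
    proof (cases "red_vec y = (False, False, False)")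
      case True
      then show ?thesis using two_dvd_tau_form_orthogonal[OF yO _ y0O y0(2)] K(3) y y0(1) by blast
    next
      case False
      with red have "red_vec y = (True, True, False)" by simp
      then have "red_vec (y - y0) = (False, False, False)"
        using y0(2) yO y0O by (simp add: red_vec_def Ovec_iff red_pi_arith)
      moreover have "y - y0 \<in> K" using gi_module_diff[OF K(1) y y0(1)] .
      ultimately have "two_dvd (tau_form j (y - y0))"
        using two_dvd_tau_form_orthogonal[OF _ _ y0O y0(2)] K y0(1) by blast
      then have "two_dvd (tau_form j (y - y0) + tau_form j y0)" using j(2) by (rule two_dvd_add)
      then show ?thesis by (simp add: tau_form_diff)
    qed
    moreover have "\<not> red_pi (y$3)" using red by (auto simp: red_vec_def)
    ultimately show ?thesis using tau_u_mult_in_unif_Ovec[OF j(1) yO] by blast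
  qed
  then show ?thesis using that j(1) by blast
qed

lemma two_dvd_hform_scaled_self_dual:
  assumes "dual L = L" "x \<in> L" "y \<in> L"
  shows "two_dvd (hform (unif ^ Suc n *s x) (unif ^ Suc n *s y))"
proof -
  have "hform x y \<in> Gint" using assms by (auto simp: dual_def)
  moreover have "unif ^ Suc n * cnj (unif ^ Suc n) = 2 * 2 ^ n"
    by (simp only: complex_cnj_power unif_mult_cnj flip: power_mult_distrib) simp
  ultimately show ?thesis by (auto simp: hform_scale two_dvd_def mult.assoc)
qed

lemma self_dual_isotropic_vector:
  assumes "dual L = L" "scaleset (unif ^ Suc n) L \<subseteq> Ovec" "x \<in> L" "unif ^ n *s x \<notin> Ovec"
  obtains a where "red_vec (mpow sigma3 a *v (unif ^ Suc n *s x)) = (True, True, False)"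
proof -
  define x0 where "x0 = unif ^ Suc n *s x"
  have x0O: "x0 \<in> Ovec" using assms(2,3) by (auto simp: x0_def scaleset_subset_iff)
  have "red_vec x0 \<noteq> (False, False, False)"
  proof
    assume "red_vec x0 = (False, False, False)"
    then have "x0 \<in> scaleset unif Ovec" using x0O by (simp add: scaleset_unif_Ovec_iff)
    then obtain z where "z \<in> Ovec" "x0 = unif *s z" by (auto simp: scaleset_def)
    moreover have "x0 = unif *s (unif ^ n *s x)" by (simp add: x0_def)
    ultimately show False using assms(4) by (metis vector_mul_lcancel unif_nonzero)
  qed
  moreover have "\<not> red_pi (hform x0 x0)"
    using two_dvd_hform_scaled_self_dual[OF assms(1,3,3)] two_dvd_imp_not_red_pi
    by (simp add: x0_def)
  ultimately obtain a where "red_vec (mpow sigma3 a *v x0) = (True, True, False)"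
    using red_vec_isotropic_sigma3[OF x0O] by blast
  then show ?thesis using that unfolding x0_def by blast
qed

lemma self_dual_lattice_step:
  assumes L: "gi_module L" "dual L = L" "scaleset (unif ^ Suc n) L \<subseteq> Ovec"
  obtains V where "V \<in> Lambda_u" "scaleset (unif ^ n) ((*v) V ` L) \<subseteq> Ovec"
proof (cases "scaleset (unif ^ n) L \<subseteq> Ovec")
  case True
  then show ?thesis using that[of "mat 1"] uword_in_Lambda_u[of "[]"] by simp
next
  case False
  then obtain x1 where x1: "x1 \<in> L" "unif ^ n *s x1 \<notin> Ovec" by (auto simp: scaleset_subset_iff)
  define P where "P = unif ^ Suc n"
  obtain a where a: "red_vec (mpow sigma3 a *v (P *s x1)) = (True, True, False)"
    using self_dual_isotropic_vector[OF L(2,3) x1] unfolding P_def .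
  define S where "S = mpow sigma3 a"
  define K where "K = (*v) S ` scaleset P L"
  have K_iff: "y \<in> K \<longleftrightarrow> (\<exists>x\<in>L. y = S *v (P *s x))" for y
    by (auto simp: K_def scaleset_def)
  have "gi_module K" unfolding K_def by (intro gi_module_image gi_module_scaleset L(1))
  moreover have "K \<subseteq> Ovec"
    using L(3) sigma3_mult_Ovec by (auto simp: K_iff S_def P_def scaleset_subset_iff)
  moreover have "\<forall>x\<in>K. \<forall>y\<in>K. two_dvd (hform x y)"
    using two_dvd_hform_scaled_self_dual[OF L(2)] hform_unitary[OF unitary_mpow[OF unitary_sigma3]]
    by (auto simp: K_iff S_def P_def)
  moreover have "S *v (P *s x1) \<in> K" "red_vec (S *v (P *s x1)) = (True, True, False)"
    using x1(1) a by (auto simp: K_iff S_def)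
  ultimately obtain j where j: "j \<in> {1, 2}" "\<forall>y\<in>K. mpow tau_u j *v y \<in> scaleset unif Ovec"
    by (rule tau_u_contracts)
  define V where "V = mpow tau_u j ** S"
  have "V \<in> Lambda_u"
    using uword_in_Lambda_u[of "[(False, j), (True, a)]"] by (simp add: V_def S_def gen_def)
  moreover have "unif ^ n *s (V *v x) \<in> Ovec" if "x \<in> L" for x
  proof -
    have "S *v (P *s x) \<in> K" using \<open>x \<in> L\<close> by (auto simp: K_iff)
    then have "mpow tau_u j *v (S *v (P *s x)) \<in> scaleset unif Ovec" using j(2) by blast
    then obtain z where "z \<in> Ovec" "mpow tau_u j *v (S *v (P *s x)) = unif *s z"
      by (auto simp: scaleset_def)
    moreover have "mpow tau_u j *v (S *v (P *s x)) = unif *s (unif ^ n *s (V *v x))"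
      by (simp add: V_def P_def vector_scalar_commute matrix_vector_mul_assoc)
    ultimately have "unif ^ n *s (V *v x) = z" by (metis vector_mul_lcancel unif_nonzero)
    with \<open>z \<in> Ovec\<close> show ?thesis by simp
  qed
  ultimately show ?thesis using that by (auto simp: scaleset_def)
qed

lemma self_dual_lattice_orbit_bounded:
  "gi_module L \<Longrightarrow> dual L = L \<Longrightarrow> scaleset (unif ^ n) L \<subseteq> Ovec \<Longrightarrow>
    \<exists>U\<in>Lambda_u. L = (*v) U ` Ovec"
proof (induct n arbitrary: L)
  case 0
  then have "L \<subseteq> Ovec" by (auto simp: scaleset_def)
  moreover from dual_antimono[OF this] have "Ovec \<subseteq> L" using 0 dual_Ovec by simp
  ultimately have "L = (*v) (uword []) ` Ovec" by simp
  then show ?case using uword_in_Lambda_u by blast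
next
  case (Suc n)
  obtain V where V: "V \<in> Lambda_u" "scaleset (unif ^ n) ((*v) V ` L) \<subseteq> Ovec"
    using self_dual_lattice_step[OF Suc.prems] .
  have u: "unitary V" using V(1) by (rule unitary_Lambda_u)
  have "gi_module ((*v) V ` L)" "dual ((*v) V ` L) = (*v) V ` L"
    using Suc.prems by (simp_all add: gi_module_image dual_image_unitary[OF u])
  then obtain U where U: "U \<in> Lambda_u" "(*v) V ` L = (*v) U ` Ovec" using Suc.hyps V(2) by blast
  have "L = (*v) (mstar V ** U) ` Ovec"
    by (metis U(2) image_matrix_mult unitary_image_cancel[OF u])
  moreover have "mstar V ** U \<in> Lambda_u" using V(1) U(1) by (simp add: Lambda_u_mult Lambda_u_mstar)
  ultimately show ?case by blast
qed

lemma self_dual_lattice_orbit: "is_lattice L \<Longrightarrow> dual L = L \<Longrightarrow> \<exists>U\<in>Lambda_u. L = (*v) U ` Ovec"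
  using is_lattice_bounded self_dual_lattice_orbit_bounded is_lattice_gi_module by blast

section \<open>Edges\<close>

lemma M_std_unique:
  assumes K: "gi_module K" "scaleset unif Ovec \<subseteq> K" "K \<subseteq> Ovec"
    "\<forall>x\<in>K. \<forall>y\<in>K. \<not> red_pi (hform x y)"
    and y0: "y0 \<in> K" "red_vec y0 = (True, True, False)"
  shows "K = M_std"
proof
  have y0O: "y0 \<in> Ovec" using K(3) y0(1) by blast
  show "K \<subseteq> M_std"
  proof
    fix y assume "y \<in> K"
    then have "y \<in> Ovec" "red_vec y = (False, False, False) \<or> red_vec y = (True, True, False)"
      using red_vec_isotropic_orthogonal[OF _ y0O] K(3,4) y0 by auto
    then show "y \<in> M_std" by (auto simp: M_std_def red_vec_def)
  qed
  show "M_std \<subseteq> K"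
  proof
    fix y assume y: "y \<in> M_std"
    then have yO: "y \<in> Ovec" by (simp add: M_std_def)
    show "y \<in> K"
    proof (cases "red_vec y = (False, False, False)")
      case True
      then show ?thesis using yO K(2) scaleset_unif_Ovec_iff by blast
    next
      case False
      then have "red_vec (y - y0) = (False, False, False)"
        using y y0(2) yO y0O by (auto simp: M_std_def red_vec_def Ovec_iff red_pi_arith)
      then have "y - y0 \<in> K" using K(2) yO y0O scaleset_unif_Ovec_iff by (auto simp: Ovec_iff)
      then have "(y - y0) + y0 \<in> K" using K(1) y0(1) unfolding gi_module_def by blast
      then show ?thesis by simp
    qed
  qed
qed

lemma edge_at_Ovec:
  assumes M: "gi_module M" "scaleset unif Ovec \<subseteq> M" "M \<subseteq> Ovec" "M \<noteq> scaleset unif Ovec"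
    "\<forall>x\<in>M. \<forall>y\<in>M. \<not> red_pi (hform x y)"
  obtains V where "V \<in> Lambda_u" "(*v) V ` Ovec = Ovec" "M = (*v) V ` M_std"
proof -
  obtain x0 where x0: "x0 \<in> M" "x0 \<notin> scaleset unif Ovec" using M(2,4) by blast
  have x0O: "x0 \<in> Ovec" using M(3) x0(1) by blast
  then have "red_vec x0 \<noteq> (False, False, False)" using x0(2) scaleset_unif_Ovec_iff by blast
  then obtain a where a: "red_vec (mpow sigma3 a *v x0) = (True, True, False)"
    using red_vec_isotropic_sigma3[OF x0O] M(5) x0(1) by blast
  define S where "S = mpow sigma3 a"
  have S: "unitary S" "(*v) S ` Ovec = Ovec"
    by (simp_all add: S_def unitary_mpow unitary_sigma3 sigma3_image_Ovec)
  have "(*v) S ` M = M_std"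
  proof (rule M_std_unique)
    show "gi_module ((*v) S ` M)" using M(1) by (rule gi_module_image)
    show "scaleset unif Ovec \<subseteq> (*v) S ` M"
      using image_mono[OF M(2), of "(*v) S"] S(2) by (simp add: scaleset_image[symmetric])
    show "(*v) S ` M \<subseteq> Ovec" using image_mono[OF M(3), of "(*v) S"] S(2) by simp
    show "\<forall>x\<in>(*v) S ` M. \<forall>y\<in>(*v) S ` M. \<not> red_pi (hform x y)"
      using M(5) by (auto simp: hform_unitary[OF S(1)])
    show "S *v x0 \<in> (*v) S ` M" "red_vec (S *v x0) = (True, True, False)"
      using x0(1) a by (simp_all add: S_def)
  qed
  then have "M = (*v) (mstar S) ` M_std" by (metis unitary_image_cancel[OF S(1)])
  moreover have "(*v) (mstar S) ` Ovec = Ovec" by (metis S unitary_image_cancel)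
  moreover have "mstar S \<in> Lambda_u"
    using Lambda_u_mstar uword_in_Lambda_u[of "[(True, a)]"] by (simp add: S_def gen_def)
  ultimately show ?thesis using that by blast
qed

lemma not_red_pi_hform_scaled_dual:
  assumes "x \<in> M" "y \<in> scaleset unif (dual M)"
  shows "\<not> red_pi (hform x y)"
proof -
  obtain z where z: "z \<in> dual M" "y = unif *s z" using assms(2) by (auto simp: scaleset_def)
  have "hform x z \<in> Gint" using z(1) assms(1) by (auto simp: dual_def)
  moreover have "hform x y = unif * (\<i> * hform x z)"
    using hform_scale[of 1 x unif z] by (simp add: z(2) unif_def complex_eq_iff)
  ultimately show ?thesis by (simp add: red_pi_arith)
qed

lemma BT_edge_orbit:
  assumes "e \<in> BT_edges"
  obtains U where "U \<in> Lambda_u" "e = ((*v) U ` Ovec, (*v) U ` M_std)"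
proof -
  obtain L0 M where e: "e = (L0, M)" and lat: "is_lattice L0" "is_lattice M" "dual L0 = L0"
    and M: "M \<subseteq> L0" "scaleset unif L0 \<subset> M" "M \<subset> scaleset unif (dual M)"
    using assms by (auto simp: BT_edges_def)
  obtain U0 where U0: "U0 \<in> Lambda_u" "L0 = (*v) U0 ` Ovec"
    using self_dual_lattice_orbit[OF lat(1,3)] by blast
  have u: "unitary U0" "unitary (mstar U0)" using U0(1) by (simp_all add: unitary_Lambda_u unitary_mstar)
  define M' where "M' = (*v) (mstar U0) ` M"
  have MM': "M = (*v) U0 ` M'" using unitary_image_cancel[OF u(2)] by (simp add: M'_def)
  have image_L0: "(*v) (mstar U0) ` L0 = Ovec" "(*v) (mstar U0) ` scaleset unif L0 = scaleset unif Ovec"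
    by (simp_all add: U0(2) scaleset_image unitary_image_cancel[OF u(1)])
  obtain V where V: "V \<in> Lambda_u" "(*v) V ` Ovec = Ovec" "M' = (*v) V ` M_std"
  proof (rule edge_at_Ovec)
    show "gi_module M'" using is_lattice_gi_module[OF lat(2)] by (simp add: M'_def gi_module_image)
    show "scaleset unif Ovec \<subseteq> M'" "M' \<subseteq> Ovec"
      using image_mono[OF M(1), of "(*v) (mstar U0)"] image_mono[OF psubset_imp_subset[OF M(2)],
          of "(*v) (mstar U0)"]
      by (simp_all add: M'_def image_L0)
    show "M' \<noteq> scaleset unif Ovec"
    proof
      assume "M' = scaleset unif Ovec"
      then have "M = scaleset unif L0" by (simp add: MM' U0(2) scaleset_image)
      then show False using M(2) by blast
    qed
    show "\<forall>x\<in>M'. \<forall>y\<in>M'. \<not> red_pi (hform x y)"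
      using not_red_pi_hform_scaled_dual M(3) by (auto simp: M'_def hform_unitary[OF u(2)])
  qed
  have "e = ((*v) (U0 ** V) ` Ovec, (*v) (U0 ** V) ` M_std)"
    by (simp add: e U0(2) MM' V(2,3) image_matrix_mult[symmetric])
  moreover have "U0 ** V \<in> Lambda_u" using U0(1) V(1) by (rule Lambda_u_mult)
  ultimately show ?thesis using that by blast
qed

lemma Lambda_u_std_edge_inj:
  assumes "U \<in> Lambda_u" "V \<in> Lambda_u"
    and "(*v) U ` Ovec = (*v) V ` Ovec" "(*v) U ` M_std = (*v) V ` M_std"
  shows "U = V"
proof -
  have v: "unitary V" using assms(2) by (rule unitary_Lambda_u)
  have "(*v) (mstar V ** U) ` X = X" if "(*v) U ` X = (*v) V ` X" for X
    using that unitary_image_cancel[OF v] by (simp add: image_matrix_mult[symmetric])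
  then have "mstar V ** U = mat 1"
    using assms Lambda_u_stabilizer_std_edge Lambda_u_mult Lambda_u_mstar by simp
  then have "V ** (mstar V ** U) = V" by simp
  then show ?thesis using v by (simp add: matrix_mul_assoc unitary_def)
qed

section \<open>The action of \<open>\<Lambda>\<^sub>2\<close> on the tree\<close>

lemma unitary_mat_norm: "unitary (mat \<zeta>) \<Longrightarrow> cmod \<zeta> = 1"
proof -
  assume "unitary (mat \<zeta>)"
  then have "\<zeta> * cnj \<zeta> = 1" by (simp add: unitary_def mstar_mat mat_mult_mat mat_eq_mat_iff)
  then have "(cmod \<zeta>)\<^sup>2 = 1" by (metis complex_norm_square of_real_eq_1_iff)
  then show ?thesis using norm_ge_zero[of \<zeta>] by (simp add: power2_eq_1_iff)
qed

lemma gscale_scalar_unitary: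
  assumes "unitDg \<xi>" "unitary U"
  shows "gscale (mat \<xi> ** U) * \<xi> \<in> Gint" "cmod (gscale (mat \<xi> ** U) * \<xi>) = 1"
proof -
  let ?g = "mat \<xi> ** U"
  have "?g ** mstar ?g = mat \<xi> ** (U ** mstar U) ** mat (cnj \<xi>)"
    by (simp add: mstar_mult mstar_mat matrix_mul_assoc)
  also have "\<dots> = mat (complex_of_real ((cmod \<xi>)\<^sup>2))"
    using assms(2) by (simp add: unitary_def mat_mult_mat flip: complex_norm_square)
  finally have g: "?g ** mstar ?g = mat (complex_of_real ((cmod \<xi>)\<^sup>2))" .
  have \<xi>: "\<xi> \<noteq> 0" "\<xi> \<in> Dg" "inverse \<xi> \<in> Dg" using assms(1) by (auto simp: unitDg_def)
  then have "(cmod (inverse \<xi>))\<^sup>2 * (cmod \<xi>)\<^sup>2 = 1" by (simp add: norm_inverse power_inverse)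
  then have "\<exists>c. c \<in> Dg \<and> (\<exists>l. ?g ** mstar ?g = mat (complex_of_real l) \<and> (cmod c)\<^sup>2 * l = 1)"
    using g \<xi>(3) by blast
  then have c: "gscale ?g \<in> Dg \<and>
      (\<exists>l. ?g ** mstar ?g = mat (complex_of_real l) \<and> (cmod (gscale ?g))\<^sup>2 * l = 1)"
    unfolding gscale_def by (rule someI_ex)
  then have "(cmod (gscale ?g * \<xi>))\<^sup>2 = 1"
    using g by (metis mat_eq_mat_iff of_real_eq_iff norm_mult power_mult_distrib)
  then show "cmod (gscale ?g * \<xi>) = 1"
    using norm_ge_zero[of "gscale ?g * \<xi>"] by (simp add: power2_eq_1_iff)
  then show "gscale ?g * \<xi> \<in> Gint" using Dg_norm_1_imp_Gint c \<xi>(2) by simp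
qed

lemma image_scale_Gint_unit:
  assumes "gi_module L" "z \<in> Gint" "cmod z = 1"
  shows "(\<lambda>x. z *s x) ` L = L"
proof
  show "(\<lambda>x. z *s x) ` L \<subseteq> L" using assms(1,2) by (auto simp: gi_module_def)
  have "z * cnj z = 1" using assms(3) complex_norm_square[of z] by simp
  show "L \<subseteq> (\<lambda>x. z *s x) ` L"
  proof
    fix x assume "x \<in> L"
    then have "cnj z *s x \<in> L" using assms(1,2) by (simp add: gi_module_def)
    moreover have "x = z *s (cnj z *s x)" using \<open>z * cnj z = 1\<close> by simp
    ultimately show "x \<in> (\<lambda>x. z *s x) ` L" by (rule rev_image_eqI)
  qed
qed

text \<open>The normalising scalar chosen by \<open>gscale\<close> differs from \<open>\<xi>\<^sup>-\<^sup>1\<close> by a unit of \<open>Z[i]\<close>, which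
  fixes every \<open>Z[i]\<close>-module.\<close>

lemma act_lat_scalar_unitary:
  assumes "unitDg \<xi>" "unitary U" "gi_module L"
  shows "act_lat (mat \<xi> ** U) L = (*v) U ` L"
proof -
  define z where "z = gscale (mat \<xi> ** U) * \<xi>"
  have "gscale (mat \<xi> ** U) *s ((mat \<xi> ** U) *v x) = U *v (z *s x)" for x
    by (simp add: z_def mat_matrix_vector_mult vector_scalar_commute
        flip: matrix_vector_mul_assoc)
  then have "act_lat (mat \<xi> ** U) L = (*v) U ` ((\<lambda>x. z *s x) ` L)"
    by (simp add: act_lat_def image_image)
  then show ?thesis
    using image_scale_Gint_unit[OF assms(3)] gscale_scalar_unitary[OF assms(1,2)] by (simp add: z_def)
qed

lemma act_edge_std:
  assumes "unitDg \<xi>" "U \<in> Lambda_u"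
  shows "act_edge (mat \<xi> ** U) ((*v) V ` Ovec, (*v) V ` M_std) =
    ((*v) (U ** V) ` Ovec, (*v) (U ** V) ` M_std)"
  using assms unitary_Lambda_u
  by (simp add: act_edge_def act_lat_scalar_unitary gi_module_image gi_module_Ovec gi_module_M_std
      image_matrix_mult)

lemma Lam2_simply_transitive_on_edges:
  assumes "e \<in> BT_edges" "e' \<in> BT_edges"
  shows "\<exists>g\<in>Lam2. act_edge g e = e' \<and> (\<forall>h\<in>Lam2. act_edge h e = e' \<longrightarrow> pgu_eq g h)"
proof -
  obtain U1 where U1: "U1 \<in> Lambda_u" "e = ((*v) U1 ` Ovec, (*v) U1 ` M_std)"
    using assms(1) by (rule BT_edge_orbit)
  obtain U2 where U2: "U2 \<in> Lambda_u" "e' = ((*v) U2 ` Ovec, (*v) U2 ` M_std)"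
    using assms(2) by (rule BT_edge_orbit)
  have u1: "U1 ** mstar U1 = mat 1" "mstar U1 ** U1 = mat 1"
    using U1(1) unitary_Lambda_u by (simp_all add: unitary_def)
  define g where "g = mat 1 ** (U2 ** mstar U1)"
  have gU: "U2 ** mstar U1 \<in> Lambda_u" using U1(1) U2(1) by (simp add: Lambda_u_mult Lambda_u_mstar)
  have "g \<in> Lam2" unfolding g_def Lam2_eq using unitDg_1 gU by blast
  moreover have "act_edge g e = e'"
    using act_edge_std[OF unitDg_1 gU] by (simp add: g_def U1(2) U2(2) u1 flip: matrix_mul_assoc)
  moreover have "pgu_eq g h" if h: "h \<in> Lam2" "act_edge h e = e'" for h
  proof -
    obtain \<eta> V where \<eta>: "unitDg \<eta>" "V \<in> Lambda_u" "h = mat \<eta> ** V"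
      using h(1) unfolding Lam2_eq by blast
    then have "V ** U1 = U2"
      using h(2) act_edge_std[OF \<eta>(1,2)] Lambda_u_mult[OF \<eta>(2) U1(1)]
      by (intro Lambda_u_std_edge_inj) (simp_all add: U1(2) U2(2) U2(1))
    then have "V = U2 ** mstar U1" by (metis matrix_mul_assoc matrix_mul_rid u1(1))
    then show ?thesis using \<eta>(1,3) by (auto simp: pgu_eq_def g_def)
  qed
  ultimately show ?thesis by blast
qed

section \<open>The presentation of \<open>\<Lambda>\<^sub>2\<close>\<close>

lemma sigma3_in_GU3: "sigma3 \<in> GU3"
proof -
  have "\<forall>i j. sigma3 $ i $ j \<in> Dg" by (simp add: forall_3 sigma3_def Gint_subset_Dg)
  moreover have "sigma3 ** mstar sigma3 = mat (complex_of_real 1)"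
    using unitary_sigma3 by (simp add: unitary_def)
  ultimately show ?thesis unfolding GU3_def using unitZh_1_2(1) by blast
qed

lemma tau3_in_GU3: "tau3 \<in> GU3"
proof -
  have "\<forall>i j. tau3 $ i $ j \<in> Dg" by (simp add: forall_3 tau3_def Gint_subset_Dg)
  moreover have "tau3 ** mstar tau3 = mat (complex_of_real 2)"
    by (simp add: tau3_def matrix_simps3 complex_eq_iff)
  ultimately show ?thesis unfolding GU3_def using unitZh_1_2(2) by blast
qed

lemma pgu_trivial_cubes: "pgu_trivial (mpow sigma3 3)" "pgu_trivial (mpow tau3 3)"
  using sigma3_cube unitDg_1 unitDg_power[OF unitDg_unif, of 3]
  by (auto simp: pgu_trivial_def mpow_tau3 tau_u_cube)

lemma alt_word_mat_not_trivial:
  assumes "alt_word w" "w \<noteq> []"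
  shows "\<not> pgu_trivial (word_mat w)"
proof
  assume "pgu_trivial (word_mat w)"
  then obtain u where u: "unitDg u" "mat (unif ^ tau_degree w) ** uword w = mat u"
    by (auto simp: pgu_trivial_def word_mat_eq_uword)
  define \<zeta> where "\<zeta> = inverse (unif ^ tau_degree w) * u"
  have "uword w = mat (inverse (unif ^ tau_degree w)) ** (mat (unif ^ tau_degree w) ** uword w)"
    by (simp add: matrix_mul_assoc mat_mult_mat)
  then have \<zeta>: "uword w = mat \<zeta>" by (simp add: u(2) \<zeta>_def mat_mult_mat)
  have "\<zeta> \<in> Dg" using u(1) unitDg_power[OF unitDg_unif]
    by (simp add: \<zeta>_def unitDg_def)
  moreover have "cmod \<zeta> = 1" using unitary_uword[of w] by (simp add: \<zeta> unitary_mat_norm)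
  ultimately show False using Dg_norm_1_imp_Gint alt_uword_not_scalar[OF assms] \<zeta> by blast
qed

theorem proposition6p2:
  shows "sigma3 \<in> GU3 \<and> tau3 \<in> GU3 \<and>
    (\<forall>e\<in>BT_edges. \<forall>e'\<in>BT_edges. \<exists>g\<in>Lam2. act_edge g e = e' \<and>
        (\<forall>h\<in>Lam2. act_edge h e = e' \<longrightarrow> pgu_eq g h)) \<and>
    pgu_trivial (mpow sigma3 3) \<and> pgu_trivial (mpow tau3 3) \<and>
    (\<forall>w. w \<noteq> [] \<and> alt_word w \<longrightarrow> \<not> pgu_trivial (word_mat w))"
  using sigma3_in_GU3 tau3_in_GU3 Lam2_simply_transitive_on_edges pgu_trivial_cubes
    alt_word_mat_not_trivial by blast

end
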